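(* Let $D$ be an $\aleph_1$-complete filter on a cardinal $\kappa$, and $\langle\lambda_i:i<\kappa\rangle$ a sequence of regular cardinals $>(2^\kappa)^+$ such that $\|\langle\lambda_i:i<\kappa\rangle\|_{D+A}=\lambda$ for every $A\in D^+$. Let $\mu_i<\mathfrak a_{\lambda_i}$ for $i<\kappa$, and assume either $\mu=\mathrm{tcf}(\prod_{i<\kappa}\mu_i/D)$, or $\mu<\mathrm{Depth}^+(\prod_{i<\kappa}\mu_i,<_D)$ and $\mu>2^\kappa$. Then $\mu<\mathfrak a_\lambda$.
   Context: $D^+=\{A\subseteq\kappa:\kappa\setminus A\notin D\}$; $D+A$ is the filter generated by $D\cup\{A\}$. For an $\aleph_1$-complete filter $E$ on $\kappa$ and $f\in{}^\kappa\mathrm{Ord}$, $\|f\|_E=\bigcup\{\|g\|_E+1:g<_E f\}$ where $g<_E f$ means $\{i:g(i)<f(i)\}\in E$. For a cardinal $\chi$, $\mathfrak a_\chi$ is the least $\nu$ such that there is no family $\mathcal P\subseteq[\chi]^\chi$ of cardinality $\nu$ with $|A\cap B|<\chi$ for distinct $A,B\in\mathcal P$. $\mathrm{Depth}^+(\prod\mu_i,<_D)$ is the least $\chi$ with no sequence of length $\chi$ in $\prod\mu_i$ strictly increasing under $<_D$; $\mathrm{tcf}$ is true cofinality. *)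

theory Defs
  imports "HOL-Library.FuncSet"
begin

unbundle cardinal_syntax

text \<open>
  Ordinals are well-orders, compared by \<open><o\<close>, \<open>\<le>o\<close> and \<open>=o\<close>; cardinals are the relations
  satisfying \<^const>\<open>card_order_on\<close> on their field. The index set \<open>\<kappa>\<close> is a type \<open>'k\<close>:
  only its cardinality is used. The improper filter is \<^term>\<open>bot\<close>.
\<close>

definition aleph1_complete :: "'k filter \<Rightarrow> bool" where
  "aleph1_complete D \<longleftrightarrow>
     (\<forall>P :: nat \<Rightarrow> 'k \<Rightarrow> bool. (\<forall>n. eventually (P n) D) \<longrightarrow> eventually (\<lambda>i. \<forall>n. P n i) D)"

definition positive_sets :: "'k filter \<Rightarrow> 'k set set" where
  "positive_sets D = {A. \<not> eventually (\<lambda>i. i \<in> - A) D}"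

definition filter_plus :: "'k filter \<Rightarrow> 'k set \<Rightarrow> 'k filter" where
  "filter_plus D A = inf D (principal A)"

text \<open>
  A value is determined up to \<open>=o\<close>, and is meaningful provided some ordinal (cardinal) on the type
  \<open>'a\<close> satisfies \<open>Q\<close>; for each use below this is proved at the end of the theory.
\<close>

definition least_ordinal :: "('a rel \<Rightarrow> bool) \<Rightarrow> 'a rel" where
  "least_ordinal Q =
     (SOME r. Well_order r \<and> Q r \<and> (\<forall>r'. Well_order r' \<and> Q r' \<longrightarrow> r \<le>o r'))"

definition least_cardinal :: "('a rel \<Rightarrow> bool) \<Rightarrow> 'a rel" where
  "least_cardinal Q =
     (SOME r. Card_order r \<and> Q r \<and> (\<forall>r'. Card_order r' \<and> Q r' \<longrightarrow> r \<le>o r'))"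

text \<open>
  In \<open>g <\<^sub>E f\<close> with \<open>f :: 'k \<Rightarrow> 'a rel\<close>, nothing is lost by letting \<open>g\<close> take values on the same type
  \<open>'a\<close>, since every ordinal below \<open>f i\<close> is isomorphic to a restriction of \<open>f i\<close>.
\<close>

definition ord_less_mod :: "'k filter \<Rightarrow> (('k \<Rightarrow> 'a rel) \<times> ('k \<Rightarrow> 'a rel)) set" where
  "ord_less_mod E = {(g, f). eventually (\<lambda>i. g i <o f i) E}"

text \<open>
  \<open>\<parallel>f\<parallel>\<^sub>E = \<Union>{\<parallel>g\<parallel>\<^sub>E + 1 | g <\<^sub>E f}\<close> is the least ordinal exceeding all \<open>\<parallel>g\<parallel>\<^sub>E\<close> for \<open>g <\<^sub>E f\<close>.
\<close>

definition gh_norm :: "'k filter \<Rightarrow> ('k \<Rightarrow> 'a rel) \<Rightarrow> ('k \<Rightarrow> 'a rel) rel" where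
  "gh_norm E = wfrec (ord_less_mod E)
     (\<lambda>N f. least_ordinal (\<lambda>r. \<forall>g. (g, f) \<in> ord_less_mod E \<longrightarrow> N g <o r))"

definition almost_disjoint_family :: "'a rel \<Rightarrow> 'a set set \<Rightarrow> bool" where
  "almost_disjoint_family chi P \<longleftrightarrow>
     P \<subseteq> {A. A \<subseteq> Field chi \<and> |A| =o chi} \<and>
     (\<forall>A\<in>P. \<forall>B\<in>P. A \<noteq> B \<longrightarrow> |A \<inter> B| <o chi)"

definition ad_number :: "'a rel \<Rightarrow> 'a set set rel" where
  "ad_number chi =
     least_cardinal (\<lambda>nu. \<not> (\<exists>P. almost_disjoint_family chi P \<and> |P| =o nu))"

definition card_prod :: "('k \<Rightarrow> 'm rel) \<Rightarrow> ('k \<Rightarrow> 'm) set" where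
  "card_prod mu = (\<Pi> i\<in>UNIV. Field (mu i))"

definition le_mod :: "'k filter \<Rightarrow> ('k \<Rightarrow> 'm rel) \<Rightarrow> ('k \<Rightarrow> 'm) \<Rightarrow> ('k \<Rightarrow> 'm) \<Rightarrow> bool" where
  "le_mod D mu f g \<longleftrightarrow> eventually (\<lambda>i. (f i, g i) \<in> mu i) D"

definition less_mod :: "'k filter \<Rightarrow> ('k \<Rightarrow> 'm rel) \<Rightarrow> ('k \<Rightarrow> 'm) \<Rightarrow> ('k \<Rightarrow> 'm) \<Rightarrow> bool" where
  "less_mod D mu f g \<longleftrightarrow> eventually (\<lambda>i. (f i, g i) \<in> mu i \<and> f i \<noteq> g i) D"

definition increasing_seq :: "'b set \<Rightarrow> ('b \<Rightarrow> 'b \<Rightarrow> bool) \<Rightarrow> 'c rel \<Rightarrow> ('c \<Rightarrow> 'b) \<Rightarrow> bool" where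
  "increasing_seq S lt chi s \<longleftrightarrow>
     (\<forall>a\<in>Field chi. s a \<in> S) \<and> (\<forall>a b. (a, b) \<in> chi \<and> a \<noteq> b \<longrightarrow> lt (s a) (s b))"

definition depth_plus :: "'b set \<Rightarrow> ('b \<Rightarrow> 'b \<Rightarrow> bool) \<Rightarrow> 'b set rel" where
  "depth_plus S lt = least_cardinal (\<lambda>chi. \<not> (\<exists>s. increasing_seq S lt chi s))"

text \<open>
  For a preorder \<open>le\<close> on \<open>S\<close>. Passing to the quotient by \<open>le f g \<and> le g f\<close> changes neither the
  existence of linearly ordered cofinal subsets nor their least cardinality.
\<close>

definition linear_cofinal :: "'b set \<Rightarrow> ('b \<Rightarrow> 'b \<Rightarrow> bool) \<Rightarrow> 'b set \<Rightarrow> bool" where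
  "linear_cofinal S le C \<longleftrightarrow>
     C \<subseteq> S \<and> (\<forall>c\<in>C. \<forall>c'\<in>C. le c c' \<or> le c' c) \<and> (\<forall>f\<in>S. \<exists>c\<in>C. le f c)"

text \<open>\<open>tcf\<close> need not exist, hence a predicate.\<close>

definition has_tcf :: "'b set \<Rightarrow> ('b \<Rightarrow> 'b \<Rightarrow> bool) \<Rightarrow> 'c rel \<Rightarrow> bool" where
  "has_tcf S le mu \<longleftrightarrow> Card_order mu \<and>
     (\<exists>C. linear_cofinal S le C \<and> |C| =o mu) \<and>
     (\<forall>C. linear_cofinal S le C \<longrightarrow> mu \<le>o |C| )"

lemma least_ordinal_props:
  assumes "Well_order r0" "Q r0"
  shows "Well_order (least_ordinal Q)" "Q (least_ordinal Q)"
    "\<And>r'. Well_order r' \<Longrightarrow> Q r' \<Longrightarrow> least_ordinal Q \<le>o r'"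
proof -
  let ?X = "{r. Well_order r \<and> Q r}"
  obtain r where r: "r \<in> ?X" and min: "\<And>y. (y, r) \<in> ordLess \<Longrightarrow> y \<notin> ?X"
    using wfE_min[OF wf_ordLess, of r0 ?X] assms by auto
  have "Well_order r \<and> Q r \<and> (\<forall>r'. Well_order r' \<and> Q r' \<longrightarrow> r \<le>o r')"
    using r min not_ordLess_iff_ordLeq by blast
  from someI[of "\<lambda>r. Well_order r \<and> Q r \<and> (\<forall>r'. Well_order r' \<and> Q r' \<longrightarrow> r \<le>o r')", OF this]
  show "Well_order (least_ordinal Q)" "Q (least_ordinal Q)"
    "\<And>r'. Well_order r' \<Longrightarrow> Q r' \<Longrightarrow> least_ordinal Q \<le>o r'"
    unfolding least_ordinal_def by blast+
qed

lemma least_cardinal_props: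
  assumes "Card_order r0" "Q r0"
  shows "Card_order (least_cardinal Q)" "Q (least_cardinal Q)"
    "\<And>r'. Card_order r' \<Longrightarrow> Q r' \<Longrightarrow> least_cardinal Q \<le>o r'"
proof -
  let ?X = "{r. Card_order r \<and> Q r}"
  obtain r where r: "r \<in> ?X" and min: "\<And>y. (y, r) \<in> ordLess \<Longrightarrow> y \<notin> ?X"
    using wfE_min[OF wf_ordLess, of r0 ?X] assms by auto
  have "Card_order r \<and> Q r \<and> (\<forall>r'. Card_order r' \<and> Q r' \<longrightarrow> r \<le>o r')"
  proof (intro conjI allI impI)
    show "Card_order r" "Q r" using r by simp_all
    fix r' assume r': "Card_order r' \<and> Q r'"
    have "Well_order r" "Well_order r'"
      using r r' card_order_on_well_order_on by auto
    moreover have "\<not> r' <o r" using min[of r'] r' by auto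
    ultimately show "r \<le>o r'" using not_ordLess_iff_ordLeq by auto
  qed
  from someI[of "\<lambda>r. Card_order r \<and> Q r \<and> (\<forall>r'. Card_order r' \<and> Q r' \<longrightarrow> r \<le>o r')", OF this]
  show "Card_order (least_cardinal Q)" "Q (least_cardinal Q)"
    "\<And>r'. Card_order r' \<Longrightarrow> Q r' \<Longrightarrow> least_cardinal Q \<le>o r'"
    unfolding least_cardinal_def by blast+
qed

lemma ad_number_props:
  fixes chi :: "'a rel"
  shows "Card_order (ad_number chi)"
    "\<not> (\<exists>P. almost_disjoint_family chi P \<and> |P| =o ad_number chi)"
    "\<And>nu :: 'a set set rel. Card_order nu \<Longrightarrow> \<not> (\<exists>P. almost_disjoint_family chi P \<and> |P| =o nu) \<Longrightarrow>
       ad_number chi \<le>o nu"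
proof -
  let ?Q = "\<lambda>nu :: 'a set set rel. \<not> (\<exists>P. almost_disjoint_family chi P \<and> |P| =o nu)"
  let ?r = "cardSuc |UNIV :: 'a set set|"
  have c: "Card_order ?r" by (rule cardSuc_Card_order[OF card_of_Card_order])
  have less: "|P| <o ?r" for P :: "'a set set"
    by (rule ordLeq_ordLess_trans[OF card_of_mono1 cardSuc_greater[OF card_of_Card_order]]) simp
  have q: "?Q ?r"
  proof
    assume "\<exists>P. almost_disjoint_family chi P \<and> |P| =o ?r"
    then obtain P :: "'a set set" where "|P| =o ?r" by (elim exE conjE)
    then show False using not_ordLess_ordIso[OF less[of P]] by (rule notE[rotated])
  qed
  note L = least_cardinal_props[of ?r ?Q, OF c q, folded ad_number_def]
  show "Card_order (ad_number chi)" by (rule L(1))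
  show "?Q (ad_number chi)" by (rule L(2))
  show "ad_number chi \<le>o nu" if "Card_order nu" "?Q nu" for nu :: "'a set set rel"
    using that by (rule L(3))
qed

lemma depth_plus_props:
  fixes S :: "'b set"
  assumes irrefl: "\<And>x. x \<in> S \<Longrightarrow> \<not> lt x x"
  shows "Card_order (depth_plus S lt)"
    "\<not> (\<exists>s. increasing_seq S lt (depth_plus S lt) s)"
    "\<And>chi :: 'b set rel. Card_order chi \<Longrightarrow> \<not> (\<exists>s. increasing_seq S lt chi s) \<Longrightarrow> depth_plus S lt \<le>o chi"
proof -
  let ?Q = "\<lambda>chi :: 'b set rel. \<not> (\<exists>s. increasing_seq S lt chi s)"
  let ?r = "cardSuc |UNIV :: 'b set|"
  have c: "Card_order ?r" by (rule cardSuc_Card_order[OF card_of_Card_order])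
  have wo: "wo_rel ?r" using card_order_on_well_order_on[OF c] unfolding wo_rel_def .
  have q: "?Q ?r"
  proof
    assume "\<exists>s. increasing_seq S lt ?r s"
    then obtain s where s: "increasing_seq S lt ?r s" ..
    have "inj_on s (Field ?r)"
    proof (rule inj_onI, rule ccontr)
      fix a b assume ab: "a \<in> Field ?r" "b \<in> Field ?r" "s a = s b" "a \<noteq> b"
      then have "(a, b) \<in> ?r \<or> (b, a) \<in> ?r"
        using wo_rel.TOTALS[OF wo] by simp
      then have "lt (s a) (s b) \<or> lt (s b) (s a)"
        using s ab(4) ab(4)[symmetric] unfolding increasing_seq_def by blast
      then have "lt (s a) (s a)" using ab(3) by simp
      moreover have "s a \<in> S" using s ab(1) unfolding increasing_seq_def by simp
      ultimately show False using irrefl by simp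
    qed
    then have "|Field ?r| \<le>o |UNIV :: 'b set|"
      by (intro card_of_ordLeq[THEN iffD1] exI[of _ s]) simp
    then have "?r \<le>o |UNIV :: 'b set|"
      by (rule ordIso_ordLeq_trans[OF ordIso_symmetric[OF card_of_Field_ordIso[OF c]]])
    then show False
      using not_ordLess_ordLeq[OF cardSuc_greater[OF card_of_Card_order]] by (rule notE[rotated])
  qed
  note L = least_cardinal_props[of ?r ?Q, OF c q, folded depth_plus_def]
  show "Card_order (depth_plus S lt)" by (rule L(1))
  show "?Q (depth_plus S lt)" by (rule L(2))
  show "depth_plus S lt \<le>o chi" if "Card_order chi" "?Q chi" for chi :: "'b set rel"
    using that by (rule L(3))
qed

lemma less_mod_irrefl: "D \<noteq> bot \<Longrightarrow> \<not> less_mod D mu f f"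
  by (simp add: less_mod_def trivial_limit_def)

lemma filter_plus_proper: "A \<in> positive_sets D \<Longrightarrow> filter_plus D A \<noteq> bot"
  unfolding positive_sets_def filter_plus_def trivial_limit_def
  by (simp add: eventually_inf_principal)

lemma filter_plus_complete: "aleph1_complete D \<Longrightarrow> aleph1_complete (filter_plus D A)"
  unfolding aleph1_complete_def filter_plus_def eventually_inf_principal
proof (intro allI impI)
  fix P :: "nat \<Rightarrow> 'a \<Rightarrow> bool"
  assume *: "\<forall>P :: nat \<Rightarrow> 'a \<Rightarrow> bool. (\<forall>n. eventually (P n) D) \<longrightarrow> (\<forall>\<^sub>F i in D. \<forall>n. P n i)"
    and "\<forall>n. \<forall>\<^sub>F x in D. x \<in> A \<longrightarrow> P n x"
  then have "\<forall>\<^sub>F i in D. \<forall>n. i \<in> A \<longrightarrow> P n i"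
    using *[rule_format, of "\<lambda>n i. i \<in> A \<longrightarrow> P n i"] by blast
  then show "\<forall>\<^sub>F x in D. x \<in> A \<longrightarrow> (\<forall>n. P n x)" by (rule eventually_mono) blast
qed

lemma wf_ord_less_mod:
  fixes E :: "'k filter"
  assumes "E \<noteq> bot" "aleph1_complete E"
  shows "wf (ord_less_mod E :: (('k \<Rightarrow> 'a rel) \<times> ('k \<Rightarrow> 'a rel)) set)"
  unfolding wf_iff_no_infinite_down_chain
proof
  assume "\<exists>f :: nat \<Rightarrow> 'k \<Rightarrow> 'a rel. \<forall>n. (f (Suc n), f n) \<in> ord_less_mod E"
  then obtain f :: "nat \<Rightarrow> 'k \<Rightarrow> 'a rel" where "\<forall>n. (f (Suc n), f n) \<in> ord_less_mod E"
    by (rule exE)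
  then have "\<forall>n. eventually (\<lambda>i. f (Suc n) i <o f n i) E"
    unfolding ord_less_mod_def by simp
  then have "eventually (\<lambda>i. \<forall>n. f (Suc n) i <o f n i) E"
    using assms(2) unfolding aleph1_complete_def by simp
  then obtain i where "\<forall>n. f (Suc n) i <o f n i"
    using eventually_happens'[OF assms(1)] by auto
  then have "\<exists>h. \<forall>n. (h (Suc n), h n) \<in> (ordLess :: ('a rel \<times> 'a rel) set)"
    by (intro exI[of _ "\<lambda>n. f n i"])
  moreover have "wf (ordLess :: ('a rel \<times> 'a rel) set)" by (rule wf_ordLess)
  ultimately show False unfolding wf_iff_no_infinite_down_chain by simp
qed

lemma trans_ord_less_mod: "trans (ord_less_mod E)"
proof (rule transI)
  fix f g h :: "'a \<Rightarrow> 'b rel"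
  assume "(f, g) \<in> ord_less_mod E" "(g, h) \<in> ord_less_mod E"
  then have "eventually (\<lambda>i. f i <o g i) E" "eventually (\<lambda>i. g i <o h i) E"
    unfolding ord_less_mod_def by auto
  then have "eventually (\<lambda>i. f i <o h i) E"
    by eventually_elim (rule ordLess_transitive)
  then show "(f, h) \<in> ord_less_mod E" unfolding ord_less_mod_def by simp
qed

lemma gh_norm_rec:
  assumes "E \<noteq> bot" "aleph1_complete E"
  shows "gh_norm E f = least_ordinal (\<lambda>r. \<forall>g. (g, f) \<in> ord_less_mod E \<longrightarrow> gh_norm E g <o r)"
proof -
  have "gh_norm E f = least_ordinal (\<lambda>r. \<forall>g. (g, f) \<in> ord_less_mod E \<longrightarrow>
      cut (gh_norm E) (ord_less_mod E) f g <o r)"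
    unfolding gh_norm_def by (subst wfrec[OF wf_ord_less_mod[OF assms]]) simp
  also have "\<dots> = least_ordinal (\<lambda>r. \<forall>g. (g, f) \<in> ord_less_mod E \<longrightarrow> gh_norm E g <o r)"
    by (rule arg_cong[of _ _ least_ordinal]) (auto simp: cut_apply fun_eq_iff)
  finally show ?thesis .
qed

lemma ex_strict_upper_bound:
  fixes N :: "'x \<Rightarrow> 'x rel"
  assumes wo: "\<And>x. x \<in> S \<Longrightarrow> Well_order (N x)"
    and dense: "\<And>x r :: 'x rel. x \<in> S \<Longrightarrow> r <o N x \<Longrightarrow> \<exists>h\<in>S. N h =o r"
  shows "\<exists>r :: 'x rel. Well_order r \<and> (\<forall>x\<in>S. N x <o r)"
proof -
  define rep where "rep x = (SOME y. y \<in> S \<and> N y =o N x)" for x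
  have rep: "rep x \<in> S \<and> N (rep x) =o N x" if "x \<in> S" for x
    unfolding rep_def using someI[of "\<lambda>y. y \<in> S \<and> N y =o N x" x] that ordIso_reflexive[OF wo]
    by blast
  have rep_eq: "rep x = rep y" if "N x =o N y" for x y
  proof -
    have "(\<lambda>z. z \<in> S \<and> N z =o N x) = (\<lambda>z. z \<in> S \<and> N z =o N y)"
      using that ordIso_transitive ordIso_symmetric by (intro ext) blast
    then show ?thesis unfolding rep_def by simp
  qed
  define Y where "Y = rep ` S"
  have YS: "Y \<subseteq> S" unfolding Y_def using rep by auto
  have Yinj: "x = y" if xy: "x \<in> Y" "y \<in> Y" "N x =o N y" for x y
  proof -
    obtain a b where ab: "a \<in> S" "x = rep a" "b \<in> S" "y = rep b" using xy unfolding Y_def by auto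
    then have "N a =o N b"
      using xy(3) rep[of a] rep[of b] ordIso_transitive ordIso_symmetric by metis
    then show ?thesis using ab rep_eq by simp
  qed
  define r where "r = {(x, y). x \<in> Y \<and> y \<in> Y \<and> N x \<le>o N y}"
  have woY: "Well_order (N x)" if "x \<in> Y" for x using that YS wo by blast
  have F: "Field r = Y"
    unfolding r_def Field_def using ordLeq_reflexive[OF woY] by auto
  have strict: "N x <o N y" if "(x, y) \<in> r - Id" for x y
    using that Yinj unfolding r_def by (auto simp: ordLeq_iff_ordLess_or_ordIso)
  have W: "Well_order r"
    unfolding well_order_on_def linear_order_on_def partial_order_on_def preorder_on_def F
  proof (intro conjI)
    show "r \<subseteq> Y \<times> Y" unfolding r_def by auto
    show "refl_on Y r" unfolding refl_on_def r_def using ordLeq_reflexive[OF woY] by auto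
    show "trans r" unfolding trans_def r_def using ordLeq_transitive by blast
    show "antisym r" unfolding antisym_def r_def using Yinj ordIso_iff_ordLeq by blast
    show "total_on Y r" unfolding total_on_def r_def using ordLeq_total woY by blast
    show "wf (r - Id)"
      by (rule wf_subset[OF wf_inv_image[OF wf_ordLess, of N]])
        (use strict in \<open>auto simp: inv_image_def\<close>)
  qed
  have sub: "Restr r (underS r y) <o r" if "y \<in> Y" for y
    using underS_Restr_ordLess[OF W] that F by blast
  have main: "y \<in> Y \<longrightarrow> N y \<le>o Restr r (underS r y)" for y
  proof (induction y rule: wf_induct[OF wf_inv_image[OF wf_ordLess, of N]])
    case (1 y)
    show ?case
    proof (intro impI, rule ccontr)
      assume y: "y \<in> Y" and n: "\<not> N y \<le>o Restr r (underS r y)"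
      let ?s = "Restr r (underS r y)"
      have ws: "Well_order ?s" using W Well_order_Restr by blast
      then have "?s <o N y" using n woY[OF y] not_ordLeq_iff_ordLess by blast
      then obtain a where a: "a \<in> S" "N a =o ?s" using dense y YS by blast
      define h where "h = rep a"
      have h: "h \<in> Y" "N h =o ?s"
        unfolding h_def Y_def using a rep[OF a(1)] ordIso_transitive by blast+
      have hy: "N h <o N y" using h(2) \<open>?s <o N y\<close> ordIso_ordLess_trans by blast
      then have mem: "h \<in> underS r y"
        unfolding underS_def r_def
        using h(1) y ordLess_imp_ordLeq ordLess_irreflexive by blast
      have IH: "N h \<le>o Restr r (underS r h)" using 1 hy h(1) by (auto simp: inv_image_def)
      have Fs: "Field ?s = underS r y"
        using Refl_Field_Restr2[of r "underS r y"] W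
        by (auto simp: order_on_defs underS_def Field_def)
      have "underS ?s h = underS r h"
      proof
        show "underS ?s h \<subseteq> underS r h" unfolding underS_def by blast
        show "underS r h \<subseteq> underS ?s h"
        proof
          fix x assume "x \<in> underS r h"
          then have x: "x \<noteq> h" "(x, h) \<in> r" unfolding underS_def by auto
          then have "N x <o N h" using strict by blast
          then have "N x <o N y" using hy ordLess_transitive by blast
          then have "x \<in> underS r y"
            using x(2) y unfolding underS_def r_def
            using ordLess_imp_ordLeq ordLess_irreflexive by blast
          then show "x \<in> underS ?s h" using x mem unfolding underS_def by blast
        qed
      qed
      moreover have "underS r h \<subseteq> underS r y"
      proof
        fix x assume "x \<in> underS r h"
        then have x: "x \<noteq> h" "(x, h) \<in> r" unfolding underS_def by auto
        then have "N x <o N y" using strict hy ordLess_transitive by blast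
        then show "x \<in> underS r y"
          using x(2) y unfolding underS_def r_def
          using ordLess_imp_ordLeq ordLess_irreflexive by blast
      qed
      ultimately have "Restr ?s (underS ?s h) = Restr r (underS r h)" by blast
      moreover have "Restr ?s (underS ?s h) <o ?s"
        using underS_Restr_ordLess[OF ws] Fs mem by blast
      ultimately have "N h <o ?s" using IH ordLeq_ordLess_trans by metis
      then show False using h(2) not_ordLess_ordIso by blast
    qed
  qed
  have "N x <o r" if "x \<in> S" for x
  proof -
    have "rep x \<in> Y" using that unfolding Y_def by blast
    then have "N (rep x) <o r" using main sub ordLeq_ordLess_trans by blast
    then show ?thesis using rep[OF that] ordIso_symmetric ordIso_ordLess_trans by blast
  qed
  then show ?thesis using W by blast
qed

lemma gh_norm_bound_ex:
  fixes E :: "'k filter" and f :: "'k \<Rightarrow> 'a rel"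
  assumes "E \<noteq> bot" "aleph1_complete E"
  shows "\<exists>r :: ('k \<Rightarrow> 'a rel) rel. Well_order r \<and>
    (\<forall>g. (g, f) \<in> ord_less_mod E \<longrightarrow> gh_norm E g <o r)"
proof (induction f rule: wf_induct[OF wf_ord_less_mod[OF assms]])
  case (1 f)
  let ?R = "ord_less_mod E :: (('k \<Rightarrow> 'a rel) \<times> ('k \<Rightarrow> 'a rel)) set"
  have tr: "(h, f) \<in> ?R" if "(h, g) \<in> ?R" "(g, f) \<in> ?R" for g h
    using that trans_ord_less_mod unfolding trans_def by blast
  have props: "Well_order (gh_norm E g)" 
      "\<And>r' :: ('k \<Rightarrow> 'a rel) rel. Well_order r' \<Longrightarrow> \<forall>h. (h, g) \<in> ?R \<longrightarrow> gh_norm E h <o r' \<Longrightarrow> gh_norm E g \<le>o r'"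
    if "(g, f) \<in> ?R" for g
  proof -
    obtain r0 :: "('k \<Rightarrow> 'a rel) rel" where "Well_order r0" "\<forall>h. (h, g) \<in> ?R \<longrightarrow> gh_norm E h <o r0"
      using 1 \<open>(g, f) \<in> ?R\<close> by blast
    note L = least_ordinal_props[of r0 "\<lambda>r. \<forall>h. (h, g) \<in> ?R \<longrightarrow> gh_norm E h <o r", OF this]
    note L = L[folded gh_norm_rec[OF assms, of g]]
    show "Well_order (gh_norm E g)" by (rule L(1))
    show "gh_norm E g \<le>o r'"
      if "Well_order r'" "\<forall>h. (h, g) \<in> ?R \<longrightarrow> gh_norm E h <o r'"
      for r' :: "('k \<Rightarrow> 'a rel) rel"
      using that by (rule L(3))
  qed
  have dense: "(g, f) \<in> ?R \<longrightarrow> (\<forall>r :: ('k \<Rightarrow> 'a rel) rel. r <o gh_norm E g \<longrightarrow>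
      (\<exists>h. (h, f) \<in> ?R \<and> gh_norm E h =o r))" for g
  proof (induction g rule: wf_induct[OF wf_ord_less_mod[OF assms]])
    case g: (1 g)
    show ?case
    proof (intro impI allI)
      fix r :: "('k \<Rightarrow> 'a rel) rel"
      assume gf: "(g, f) \<in> ?R" and r: "r <o gh_norm E g"
      have wr: "Well_order r" using r unfolding ordLess_def by blast
      have "\<not> gh_norm E g \<le>o r" using r not_ordLess_ordLeq by blast
      then obtain h where h: "(h, g) \<in> ?R" "\<not> gh_norm E h <o r" using props(2)[OF gf wr] by blast
      have hf: "(h, f) \<in> ?R" using tr[OF h(1) gf] .
      have "r \<le>o gh_norm E h" using h(2) wr props(1)[OF hf] not_ordLess_iff_ordLeq by blast
      then consider "r <o gh_norm E h" | "gh_norm E h =o r"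
        using ordLeq_iff_ordLess_or_ordIso ordIso_symmetric by blast
      then show "\<exists>h. (h, f) \<in> ?R \<and> gh_norm E h =o r"
        using g h(1) hf by cases blast+
    qed
  qed
  from ex_strict_upper_bound[of "{g. (g, f) \<in> ?R}" "gh_norm E"] props(1) dense
  show ?case by auto
qed

lemma gh_norm_props:
  fixes E :: "'k filter" and f :: "'k \<Rightarrow> 'a rel"
  assumes "E \<noteq> bot" "aleph1_complete E"
  shows "Well_order (gh_norm E f)"
    "\<And>g. (g, f) \<in> ord_less_mod E \<Longrightarrow> gh_norm E g <o gh_norm E f"
    "\<And>r :: ('k \<Rightarrow> 'a rel) rel. Well_order r \<Longrightarrow> (\<And>g. (g, f) \<in> ord_less_mod E \<Longrightarrow> gh_norm E g <o r) \<Longrightarrow> gh_norm E f \<le>o r"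
proof -
  obtain r0 :: "('k \<Rightarrow> 'a rel) rel"
    where "Well_order r0" "\<forall>g. (g, f) \<in> ord_less_mod E \<longrightarrow> gh_norm E g <o r0"
    using gh_norm_bound_ex[OF assms] by blast
  note L = least_ordinal_props[of r0 "\<lambda>r. \<forall>g. (g, f) \<in> ord_less_mod E \<longrightarrow> gh_norm E g <o r", OF this]
  note L = L[folded gh_norm_rec[OF assms, of f]]
  show "Well_order (gh_norm E f)" by (rule L(1))
  show "gh_norm E g <o gh_norm E f" if "(g, f) \<in> ord_less_mod E" for g
    using L(2) that by simp
  show "gh_norm E f \<le>o r"
    if "Well_order r" "\<And>g. (g, f) \<in> ord_less_mod E \<Longrightarrow> gh_norm E g <o r"
    for r :: "('k \<Rightarrow> 'a rel) rel"
    by (rule L(3)) (use that in simp_all)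
qed

end

theory Submission
  imports Defs "HOL-Library.Countable_Set"
begin

text \<open>
  For each \<open>i\<close> fix an almost disjoint family of \<open>\<mu>\<^sub>i\<close> subsets of \<open>\<lambda>\<^sub>i\<close> of size \<open>\<lambda>\<^sub>i\<close>. A \<open><\<^sub>D\<close>-increasing
  sequence in \<open>\<Prod> \<mu>\<^sub>i\<close> of length \<open>\<mu>\<close> selects for each \<open>\<alpha> < \<mu>\<close> a sequence of sets \<open>X\<^sub>\<alpha> i \<subseteq> \<lambda>\<^sub>i\<close> such that
  for \<open>\<alpha> \<noteq> \<beta>\<close> the intersection \<open>X\<^sub>\<alpha> i \<inter> X\<^sub>\<beta> i\<close> is bounded in \<open>\<lambda>\<^sub>i\<close> for \<open>D\<close>-almost all \<open>i\<close>, say by \<open>\<gamma> i\<close>.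

  Functions in \<open>\<Prod> \<lambda>\<^sub>i\<close> can be coded by ordinals below \<open>\<lambda>\<close> so that functions with the same code agree on
  a \<open>D\<close>-positive set. Indeed, let \<open>Z\<close> be a maximal set of pairwise \<open>D\<close>-almost everywhere different
  functions. If two members of \<open>Z\<close> have the same norm, then neither lies pointwise below the other, as
  the norm is strictly monotone. Among more than \<open>2\<^sup>\<kappa>\<close> (and infinitely many) functions there are two
  that are pointwise comparable (by an Erdos-Rado argument), so \<open>|Z| \<le> \<lambda> \<cdot> 2\<^sup>\<kappa> = \<lambda>\<close>. Code \<open>h\<close> by some \<open>z \<in> Z\<close> that
  agrees with \<open>h\<close> on a positive set, together with that set.

  For \<open>\<zeta> < \<lambda>\<close> choose \<open>g\<^sub>\<zeta>\<close> of norm \<open>\<zeta>\<close>, and \<open>h\<^sub>\<alpha>\<^sub>,\<^sub>\<zeta> \<ge> g\<^sub>\<zeta>\<close> with \<open>h\<^sub>\<alpha>\<^sub>,\<^sub>\<zeta> i \<in> X\<^sub>\<alpha> i\<close>. The functions that map \<open>\<zeta>\<close> to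
  the code of \<open>h\<^sub>\<alpha>\<^sub>,\<^sub>\<zeta>\<close>, for \<open>\<alpha> < \<mu>\<close>, have almost disjoint graphs: if they agree at \<open>\<zeta>\<close> for
  \<open>\<alpha> \<noteq> \<beta>\<close>, then \<open>h\<^sub>\<alpha>\<^sub>,\<^sub>\<zeta> < \<gamma>\<close> on some positive \<open>A\<close>, so \<open>\<zeta> < \<parallel>\<gamma>\<parallel>\<^bsub>D + A\<^esub>\<close>; and these at most \<open>2\<^sup>\<kappa>\<close> ordinals are
  bounded below \<open>\<lambda>\<close>.
\<close>

section \<open>An Erdos-Rado bound\<close>

text \<open>Induction along the converse order: the part of \<open>K\<close> above \<open>y\<close>
  consists of \<open>y\<close> and the part above the next element of \<open>K\<close>. The least
  element of \<open>K\<close> has all of \<open>K\<close> above it.\<close>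

lemma finite_if_wf_converse:
  assumes wo: "Well_order w" and K: "K \<subseteq> Field w"
    and wf: "wf {(y, x). x \<in> K \<and> y \<in> K \<and> (x, y) \<in> w \<and> x \<noteq> y}"
  shows "finite K"
proof -
  have wr: "wo_rel w" using wo unfolding wo_rel_def .
  have tr: "\<And>x y z. (x, y) \<in> w \<Longrightarrow> (y, z) \<in> w \<Longrightarrow> (x, z) \<in> w"
    using wo_rel.TRANS[OF wr] unfolding trans_def by blast
  have least: "\<exists>m\<in>X. \<forall>z\<in>X. (m, z) \<in> w" if "X \<subseteq> Field w" "X \<noteq> {}" for X
    using wo_rel.minim_in[OF wr that] wo_rel.minim_least[OF wr that(1)] by blast
  have up: "y \<in> K \<longrightarrow> finite {z \<in> K. (y, z) \<in> w}" for y
  proof (induction y rule: wf_induct[OF wf])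
    case (1 y)
    show ?case
    proof
      assume y: "y \<in> K"
      let ?X = "{z \<in> K. (y, z) \<in> w \<and> y \<noteq> z}"
      show "finite {z \<in> K. (y, z) \<in> w}"
      proof (cases "?X = {}")
        case True
        then have "{z \<in> K. (y, z) \<in> w} \<subseteq> {y}" by blast
        then show ?thesis using finite_subset by blast
      next
        case False
        then obtain m where m: "m \<in> ?X" "\<forall>z\<in>?X. (m, z) \<in> w" using least[of ?X] K by blast
        then have "finite {z \<in> K. (m, z) \<in> w}" using 1 y by blast
        moreover have "{z \<in> K. (y, z) \<in> w} \<subseteq> insert y {z \<in> K. (m, z) \<in> w}" using m(2) by blast
        ultimately show ?thesis using finite_subset[of _ "insert y {z \<in> K. (m, z) \<in> w}"] by simp
      qed
    qed
  qed
  show ?thesis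
  proof (cases "K = {}")
    case False
    then obtain m where m: "m \<in> K" "\<forall>z\<in>K. (m, z) \<in> w" using least K by blast
    then have "K \<subseteq> {z \<in> K. (m, z) \<in> w}" by blast
    then show ?thesis using up m(1) finite_subset by blast
  qed simp
qed

text \<open>
  In the Erdos-Rado tree, every node \<open>x\<close> is determined by the order and the colours of its set \<open>P x\<close> of
  predecessors; well-foundedness makes each colour finite there, so \<open>P x\<close> embeds into \<open>'k \<times> nat\<close>.
  The codomain \<open>Pow (('k \<times> nat) \<times> 'k \<times> nat)\<close> is too large if \<open>'k\<close> is finite, but then \<open>P x\<close> is finite.
\<close>

lemma card_of_ordLeq_by_colouring:
  fixes c :: "'b \<Rightarrow> 'b \<Rightarrow> 'k"
  assumes wo: "well_order_on W w"
    and wf: "\<And>i. wf {(y, x). (x, y) \<in> w \<and> x \<noteq> y \<and> c x y = i}"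
    and R: "Cinfinite R" "|UNIV :: 'k set set| \<le>o R"
  shows "|W| \<le>o R"
proof -
  have F: "Field w = W" using well_order_on_Well_order[OF wo] by simp
  have W: "Well_order w" using well_order_on_Well_order[OF wo] by simp
  have wr: "wo_rel w" using W unfolding wo_rel_def .
  define lt where "lt x y \<longleftrightarrow> (x, y) \<in> w \<and> x \<noteq> y" for x y
  have wfl: "wf {(x, y). lt x y}"
    using wo_rel.WF[OF wr] by (rule wf_subset) (auto simp: lt_def)
  have lt_tr: "\<And>x y z. lt x y \<Longrightarrow> lt y z \<Longrightarrow> lt x z"
    using wo_rel.TRANS[OF wr] wo_rel.ANTISYM[OF wr] unfolding lt_def trans_def antisym_def by metis
  have lt_lin: "\<And>x y. x \<in> W \<Longrightarrow> y \<in> W \<Longrightarrow> x \<noteq> y \<Longrightarrow> lt x y \<or> lt y x"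
    using wo_rel.TOTALS[OF wr] F unfolding lt_def by blast
  have lt_irr: "\<not> lt x x" for x unfolding lt_def by simp
  \<comment> \<open>Tree predecessors of \<open>x\<close>: those \<open>y\<close> below
    \<open>x\<close> that no tree predecessor of \<open>y\<close> can tell from \<open>x\<close> by
    colour.\<close>
  define P where "P = wfrec {(x, y). lt x y} (\<lambda>P x. {y. lt y x \<and> (\<forall>z\<in>P y. c z y = c z x)})"
  have P: "P x = {y. lt y x \<and> (\<forall>z\<in>P y. c z y = c z x)}" for x
    unfolding P_def by (subst wfrec[OF wfl]) (auto simp: cut_apply)
  have Pl: "y \<in> P x \<Longrightarrow> lt y x" and Pc: "y \<in> P x \<Longrightarrow> z \<in> P y \<Longrightarrow> c z y = c z x" for x y z
    using P by blast+
  have PW: "y \<in> P x \<Longrightarrow> y \<in> W" for x y using Pl F unfolding lt_def Field_def by blast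
  have Ptr: "z \<in> P y \<longrightarrow> y \<in> P x \<longrightarrow> z \<in> P x" for x y z
  proof (induction z arbitrary: x y rule: wf_induct_rule[OF wfl])
    case (1 z)
    show ?case
    proof (intro impI)
      assume z: "z \<in> P y" and y: "y \<in> P x"
      have "c u z = c u x" if u: "u \<in> P z" for u
      proof -
        have "u \<in> P y" using 1[of u z y] u z Pl by blast
        then show ?thesis using Pc[OF z u] Pc[OF y] by simp
      qed
      then show "z \<in> P x" using lt_tr[OF Pl[OF z] Pl[OF y]] by (subst P) blast
    qed
  qed
  have Plin: "y \<in> P x \<longrightarrow> y' \<in> P x \<longrightarrow> lt y y' \<longrightarrow> y \<in> P y'" for x y y'
  proof (induction y rule: wf_induct_rule[OF wfl])
    case (1 y)
    show ?case
    proof (intro impI)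
      assume y: "y \<in> P x" and y': "y' \<in> P x" and l: "lt y y'"
      have "c z y = c z y'" if z: "z \<in> P y" for z
      proof -
        have "z \<in> P y'" using 1[of z] z Pl[OF z] Ptr y y' lt_tr l by blast
        then show ?thesis using Pc[OF y z] Pc[OF y'] by simp
      qed
      then show "y \<in> P y'" using l by (subst P) blast
    qed
  qed
  \<comment> \<open>Otherwise the smaller of the two nodes would qualify as a tree predecessor of
    the larger one, hence of itself.\<close>
  have sep: "x = y" if xy: "x \<in> W" "y \<in> W" "P x = P y" "\<forall>z\<in>P x. c z x = c z y" for x y
  proof (rule ccontr)
    assume "x \<noteq> y"
    then consider "lt x y" | "lt y x" using lt_lin xy(1,2) by blast
    then show False
    proof cases
      case 1
      then have "x \<in> P y" using xy(4) by (subst P) blast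
      then show False using xy(3) Pl lt_irr by blast
    next
      case 2
      then have "y \<in> P x" using xy(3,4) by (subst P) auto
      then show False using xy(3) Pl lt_irr by blast
    qed
  qed
  \<comment> \<open>Within \<open>P x\<close> the colour of a pair is the colour of its smaller
    member with \<open>x\<close>. So a colour class towards \<open>x\<close> is homogeneous, and its
    converse order is well-founded by \<open>wf\<close>.\<close>
  have fin: "finite {y \<in> P x. c y x = i}" for x i
  proof (rule finite_if_wf_converse[OF W])
    show "{y \<in> P x. c y x = i} \<subseteq> Field w" using PW F by blast
    show "wf {(y', y). y \<in> {y \<in> P x. c y x = i} \<and> y' \<in> {y \<in> P x. c y x = i} \<and> (y, y') \<in> w \<and> y \<noteq> y'}"
    proof (rule wf_subset[OF wf[of i]])
      have "c y y' = i" if a: "y \<in> P x" "c y x = i" "y' \<in> P x" "(y, y') \<in> w" "y \<noteq> y'" for y y'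
        proof -
        have "y \<in> P y'" using Plin a unfolding lt_def by blast
        then show ?thesis using Pc[OF a(3)] Pc[OF a(3), of y] Pc a(2) by simp
      qed
      then show "{(y', y). y \<in> {y \<in> P x. c y x = i} \<and> y' \<in> {y \<in> P x. c y x = i} \<and> (y, y') \<in> w \<and> y \<noteq> y'}
        \<subseteq> {(y, x). (x, y) \<in> w \<and> x \<noteq> y \<and> c x y = i}"
        by auto
    qed
  qed
  then have "\<forall>x i. \<exists>f :: 'b \<Rightarrow> nat. inj_on f {y \<in> P x. c y x = i}"
    using finite_imp_inj_to_nat_seg by blast
  then obtain ix :: "'b \<Rightarrow> 'k \<Rightarrow> 'b \<Rightarrow> nat" where ix: "\<And>x i. inj_on (ix x i) {y \<in> P x. c y x = i}"
    by metis
  define code where "code x y = (c y x, ix x (c y x) y)" for x y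
  have code_inj: "inj_on (code x) (P x)" for x
    using ix[of x] unfolding code_def inj_on_def by auto
  \<comment> \<open>\<open>E x\<close> transports the order of \<open>P x\<close> to codes, and each
    code records the colour towards \<open>x\<close>; so \<open>E x\<close> will determine the node
    \<open>x\<close>.\<close>
  define E where "E x = {(code x y, code x y') | y y'. y \<in> P x \<and> y' \<in> P x \<and> (y, y') \<in> w}" for x
  have E_iff: "(code x y, code x y') \<in> E x \<longleftrightarrow> (y, y') \<in> w" if "y \<in> P x" "y' \<in> P x" for x y y'
  proof
    assume "(code x y, code x y') \<in> E x"
    then obtain u u' where "u \<in> P x" "u' \<in> P x" "(u, u') \<in> w" "code x y = code x u" "code x y' = code x u'"
      unfolding E_def by auto
    then show "(y, y') \<in> w" using inj_onD[OF code_inj] that by metis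
  qed (use that in \<open>auto simp: E_def\<close>)
  have wrefl: "y \<in> W \<Longrightarrow> (y, y) \<in> w" for y using wo_rel.REFL[OF wr] F unfolding refl_on_def by blast
  \<comment> \<open>Induction on \<open>y\<close>: the \<open>y'\<close> in \<open>P x'\<close> with
    the same code has the same tree predecessors as \<open>y\<close> and receives the same colours
    from them, so \<open>sep\<close> gives \<open>y = y'\<close>.\<close>
  have E_sub: "y \<in> P x' \<and> code x' y = code x y"
    if x: "x \<in> W" "x' \<in> W" "E x = E x'" "y \<in> P x" for x x' y
    using that(4)
  proof (induction y rule: wf_induct_rule[OF wfl])
    case (1 y)
    have ex: "\<exists>z'\<in>P x'. code x' z' = code x z" if z: "z \<in> P x" for z
    proof -
      have "(code x z, code x z) \<in> E x'" using z wrefl PW x(3) unfolding E_def by blast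
      then show ?thesis unfolding E_def by auto
    qed
    have ord: "(z, u) \<in> w \<longleftrightarrow> (z', u') \<in> w"
      if "z \<in> P x" "u \<in> P x" "z' \<in> P x'" "u' \<in> P x'" "code x' z' = code x z" "code x' u' = code x u"
      for z u z' u'
      using E_iff[OF that(1,2)] E_iff[OF that(3,4)] that(5,6) x(3) by simp
    obtain y' where y': "y' \<in> P x'" "code x' y' = code x y" using ex[OF 1(2)] by blast
    have cx: "c z x = c z' x'" if "code x' z' = code x z" for z z'
      using that unfolding code_def by simp
    have sub: "z \<in> P y' \<and> code x' z = code x z" if z: "z \<in> P y" for z
    proof -
      have zx: "z \<in> P x" using z 1(2) Ptr by blast
      have *: "z \<in> P x'" "code x' z = code x z" using 1(1)[of z] Pl[OF z] zx by auto
      have "(z, y) \<in> w" "z \<noteq> y" using Pl[OF z] unfolding lt_def by auto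
      then have "(z, y') \<in> w" using ord[OF zx 1(2) *(1) y'(1) *(2) y'(2)] by simp
      moreover have "z \<noteq> y'"
        using *(2) y'(2) code_inj[of x] zx 1(2) \<open>z \<noteq> y\<close> unfolding inj_on_def by metis
      ultimately show ?thesis using Plin *(1,2) y'(1) unfolding lt_def by blast
    qed
    moreover have "z \<in> P y" if z: "z \<in> P y'" for z
    proof -
      have zx: "z \<in> P x'" using z y'(1) Ptr by blast
      obtain u where u: "u \<in> P x" "code x' z = code x u"
      proof -
        have "(code x' z, code x' z) \<in> E x" using zx wrefl PW x(3) unfolding E_def by blast
        then show thesis using that unfolding E_def by auto
      qed
      have "(z, y') \<in> w" "z \<noteq> y'" using Pl[OF z] unfolding lt_def by auto
      then have "(u, y) \<in> w" using ord[OF u(1) 1(2) zx y'(1) u(2) y'(2)] by simp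
      moreover have "u \<noteq> y"
        using u(2) y'(2) code_inj[of x'] zx y'(1) \<open>z \<noteq> y'\<close> unfolding inj_on_def by metis
      ultimately have uy: "lt u y" unfolding lt_def by simp
      then have "u \<in> P x'" "code x' u = code x u" using 1(1) u(1) by auto
      then have "u = z" using code_inj[of x'] u(2) zx unfolding inj_on_def by metis
      then show ?thesis using Plin u(1) 1(2) uy by blast
    qed
    ultimately have Py: "P y = P y'" by blast
    have "c z y = c z y'" if z: "z \<in> P y" for z
      using Pc[OF 1(2) z] Pc[OF y'(1), of z] sub[OF z] cx[of z z] by simp
    then have "y = y'" using sep Py PW 1(2) y'(1) by blast
    then show ?case using y' by simp
  qed
  have E_inj: "inj_on E W"
  proof (rule inj_onI)
    fix x x' assume x: "x \<in> W" "x' \<in> W" "E x = E x'"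
    have "P x = P x'"
    proof (intro set_eqI iffI)
      show "y \<in> P x'" if "y \<in> P x" for y using E_sub[OF x that] by simp
      show "y \<in> P x" if "y \<in> P x'" for y using E_sub[OF x(2,1) x(3)[symmetric] that] by simp
    qed
    moreover have "\<forall>z\<in>P x. c z x = c z x'"
      using E_sub[OF x] unfolding code_def by simp
    ultimately show "x = x'" using sep x by blast
  qed
  show ?thesis
  proof (cases "finite (UNIV :: 'k set)")
    case True
    have fP: "finite (P x)" for x
    proof -
      have "finite (\<Union>i\<in>UNIV. {y \<in> P x. c y x = i})" by (intro finite_UN_I True fin)
      then show ?thesis by (rule rev_finite_subset) auto
    qed
    have "finite (E x)" for x
    proof -
      have "E x \<subseteq> code x ` P x \<times> code x ` P x" unfolding E_def by blast
      then show ?thesis by (rule finite_subset) (simp add: fP)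
    qed
    then have "E ` W \<subseteq> Fpow UNIV" unfolding Fpow_def by blast
    moreover have "countable (UNIV :: (('k \<times> nat) \<times> ('k \<times> nat)) set)"
      unfolding UNIV_Times_UNIV[symmetric]
      by (intro countable_SIGMA countable_finite[OF True] countableI_type)
    ultimately have "countable (E ` W)" using countable_Fpow countable_subset by blast
    then have "countable W" using E_inj countable_image_inj_on by blast
    then have "|W| \<le>o |UNIV :: nat set|" unfolding countable_def card_of_ordLeq[symmetric] by simp
    also have "|UNIV :: nat set| =o natLeq" by (rule card_of_nat)
    also have "natLeq \<le>o R" using R(1) natLeq_ordLeq_cinfinite by blast
    finally show ?thesis .
  next
    case False
    have "|W| \<le>o |Pow (UNIV :: (('k \<times> nat) \<times> ('k \<times> nat)) set)|"
      using E_inj card_of_ordLeq[of W] by blast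
    also have "|Pow (UNIV :: (('k \<times> nat) \<times> ('k \<times> nat)) set)| \<le>o |Pow (UNIV :: 'k set)|"
    proof -
      note prod = card_of_Times_ordLeq_infinite_Field[of "|UNIV :: 'k set|", unfolded Field_card_of,
        OF False _ _ card_of_card_order_on]
      have "|UNIV :: nat set| \<le>o |UNIV :: 'k set|" using False infinite_iff_card_of_nat by blast
      then have *: "|(UNIV :: 'k set) \<times> (UNIV :: nat set)| \<le>o |UNIV :: 'k set|"
        by (rule prod[OF card_of_mono1[OF subset_refl]])
      have "|((UNIV :: 'k set) \<times> (UNIV :: nat set)) \<times> ((UNIV :: 'k set) \<times> (UNIV :: nat set))| \<le>o |UNIV :: 'k set|"
        by (rule prod[OF * *])
      then obtain f :: "('k \<times> nat) \<times> ('k \<times> nat) \<Rightarrow> 'k" where "inj f"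
        unfolding card_of_ordLeq[symmetric] by auto
      then have "inj_on ((`) f) (Pow UNIV)" using inj_on_image_Pow by blast
      then show ?thesis unfolding card_of_ordLeq[symmetric] by auto
    qed
    also have "|Pow (UNIV :: 'k set)| \<le>o R" using R(2) by simp
    finally show ?thesis .
  qed
qed

section \<open>Galvin-Hajnal norms\<close>

text \<open>The ordinal that a point of a well-order stands for. It turns functions into the fields
  of the \<open>lam i\<close> into ordinal-valued ones, to which \<open>gh_norm\<close>
  applies.\<close>

definition seg :: "'a rel \<Rightarrow> 'a \<Rightarrow> 'a rel" where
  "seg r x = Restr r (underS r x)"

lemma seg_less:
  assumes "Well_order r" "(x, y) \<in> r" "x \<noteq> y"
  shows "seg r x <o seg r y"
proof -
  have wr: "wo_rel r" using assms(1) unfolding wo_rel_def .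
  have "underS r x \<subseteq> underS r y"
    by (rule underS_incr[OF wo_rel.TRANS[OF wr] wo_rel.ANTISYM[OF wr] assms(2)])
  moreover have "x \<in> underS r y" "x \<notin> underS r x" using assms(2,3) unfolding underS_def by auto
  ultimately have "underS r x \<subset> underS r y" by blast
  then show ?thesis
    using ofilter_subset_ordLess[OF assms(1) wo_rel.underS_ofilter[OF wr] wo_rel.underS_ofilter[OF wr]]
    unfolding seg_def by blast
qed

lemma Well_order_seg: "Well_order r \<Longrightarrow> Well_order (seg r x)"
  unfolding seg_def by (rule Well_order_Restr)

lemma seg_le:
  assumes "Well_order r" "(x, y) \<in> r"
  shows "seg r x \<le>o seg r y"
  using seg_less[OF assms] ordLeq_reflexive[OF Well_order_seg[OF assms(1)]] ordLess_imp_ordLeq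
  by (cases "x = y") auto

lemma seg_less_self: "Well_order r \<Longrightarrow> x \<in> Field r \<Longrightarrow> seg r x <o r"
  unfolding seg_def by (rule underS_Restr_ordLess) auto

lemma ordLess_ex_seg: "r' <o r \<Longrightarrow> \<exists>a\<in>Field r. r' =o seg r a"
  unfolding seg_def using ordLess_iff_ordIso_Restr[of r r'] unfolding ordLess_def by blast

lemma Well_order_less_or_le:
  assumes "Well_order r" "x \<in> Field r" "y \<in> Field r"
  shows "(x, y) \<in> r \<and> x \<noteq> y \<or> (y, x) \<in> r"
  using wo_rel.TOTALS[of r] assms unfolding wo_rel_def by blast

lemma seg_less_imp_underS:
  assumes "Well_order r" "x \<in> Field r" "y \<in> Field r" "seg r x <o seg r y"
  shows "x \<in> underS r y"
  using Well_order_less_or_le[OF assms(1-3)] seg_le[OF assms(1), of y x] assms(4) not_ordLess_ordLeq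
  unfolding underS_def by blast

lemma gh_norm_mono:
  fixes f g :: "'k \<Rightarrow> 'a rel"
  assumes E: "E \<noteq> bot" "aleph1_complete E" and le: "eventually (\<lambda>i. f i \<le>o g i) E"
  shows "gh_norm E f \<le>o gh_norm E g"
proof (rule gh_norm_props(3)[OF E gh_norm_props(1)[OF E]])
  fix h :: "'k \<Rightarrow> 'a rel" assume "(h, f) \<in> ord_less_mod E"
  then have "eventually (\<lambda>i. h i <o f i) E" unfolding ord_less_mod_def by simp
  then have "eventually (\<lambda>i. h i <o g i) E"
    using le by eventually_elim (rule ordLess_ordLeq_trans)
  then show "gh_norm E h <o gh_norm E g"
    by (intro gh_norm_props(2)[OF E]) (simp add: ord_less_mod_def)
qed

lemma gh_norm_strict_mono:
  fixes f g :: "'k \<Rightarrow> 'a rel"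
  assumes E: "E \<noteq> bot" "aleph1_complete E" and less: "eventually (\<lambda>i. f i <o g i) E"
  shows "gh_norm E f <o gh_norm E g"
  using gh_norm_props(2)[OF E] less unfolding ord_less_mod_def by blast

text \<open>Every relation \<open>h < f\<close> modulo \<open>D\<close> persists modulo a filter
  with more sets, so by induction along \<open>ord_less_mod D\<close> the norm can only
  grow.\<close>

lemma gh_norm_filter_plus:
  fixes f :: "'k \<Rightarrow> 'a rel"
  assumes D: "D \<noteq> bot" "aleph1_complete D" and A: "A \<in> positive_sets D"
  shows "gh_norm D f \<le>o gh_norm (filter_plus D A) f"
proof (induction f rule: wf_induct_rule[OF wf_ord_less_mod[OF D]])
  case (1 f)
  note E = filter_plus_proper[OF A] filter_plus_complete[OF D(2), of A]
  show ?case
  proof (rule gh_norm_props(3)[OF D gh_norm_props(1)[OF E]])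
    fix h assume h: "(h, f) \<in> ord_less_mod D"
    then have "eventually (\<lambda>i. h i <o f i) D" unfolding ord_less_mod_def by simp
    then have "eventually (\<lambda>i. h i <o f i) (filter_plus D A)"
      unfolding filter_plus_def by (rule filter_leD[OF inf_le1])
    then show "gh_norm D h <o gh_norm (filter_plus D A) f"
      using 1[OF h] gh_norm_strict_mono[OF E] ordLeq_ordLess_trans by blast
  qed
qed

text \<open>The norms of the functions below \<open>f\<close> form an initial segment: minimality of
  the norm of \<open>f\<close> yields some \<open>h\<close> below \<open>f\<close> of norm at least
  \<open>r\<close>, and if its norm is larger the search continues below \<open>h\<close>.\<close>

lemma gh_norm_dense:
  fixes f :: "'k \<Rightarrow> 'a rel" and r :: "('k \<Rightarrow> 'a rel) rel"
  assumes E: "E \<noteq> bot" "aleph1_complete E" and r: "r <o gh_norm E f"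
  shows "\<exists>g. (g, f) \<in> ord_less_mod E \<and> gh_norm E g =o r"
  using r
proof (induction f rule: wf_induct_rule[OF wf_ord_less_mod[OF E]])
  case (1 f)
  have wr: "Well_order r" using 1(2) unfolding ordLess_def by blast
  have "\<not> gh_norm E f \<le>o r" using 1(2) not_ordLess_ordLeq by blast
  then obtain h where h: "(h, f) \<in> ord_less_mod E" "\<not> gh_norm E h <o r"
    using gh_norm_props(3)[OF E wr] by blast
  then have "r \<le>o gh_norm E h" using wr gh_norm_props(1)[OF E] not_ordLess_iff_ordLeq by blast
  then consider "r <o gh_norm E h" | "gh_norm E h =o r"
    using ordLeq_iff_ordLess_or_ordIso ordIso_symmetric by blast
  then show ?case
  proof cases
    case 1
    then obtain g where g: "(g, h) \<in> ord_less_mod E" "gh_norm E g =o r"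
      using "1.IH"[OF h(1)] by blast
    then show ?thesis using transD[OF trans_ord_less_mod g(1) h(1)] by blast
  next
    case 2
    then show ?thesis using h(1) by blast
  qed
qed

section \<open>Regular cardinals with the same norm modulo every positive set\<close>

locale constant_norm =
  fixes D :: "'k filter" and lam :: "'k \<Rightarrow> 'a rel" and lambda :: "'l rel"
  assumes D: "D \<noteq> bot" "aleph1_complete D"
    and lam: "\<And>i. Card_order (lam i)" "\<And>i. cinfinite (lam i)" "\<And>i. regularCard (lam i)"
    and large: "\<And>i. |UNIV :: 'k set set| <o lam i"
    and lambda: "Card_order lambda"
    and norm: "\<And>A. A \<in> positive_sets D \<Longrightarrow> gh_norm (filter_plus D A) lam =o lambda"
begin

definition points :: "('k \<Rightarrow> 'a) set" where
  "points = {g. \<forall>i. g i \<in> Field (lam i)}"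

definition pnorm :: "'k filter \<Rightarrow> ('k \<Rightarrow> 'a) \<Rightarrow> ('k \<Rightarrow> 'a rel) rel" where
  "pnorm E g = gh_norm E (\<lambda>i. seg (lam i) (g i))"

text \<open>A copy of \<open>lambda\<close> on the type in which norms live, so that
  \<open>gh_norm_dense\<close> applies to its initial segments.\<close>

definition Lam :: "('k \<Rightarrow> 'a rel) rel" where
  "Lam = gh_norm D lam"

lemma wo_lam: "Well_order (lam i)"
  using lam(1) by (rule card_order_on_well_order_on)

lemma filter_plus_UNIV: "filter_plus D UNIV = D"
  unfolding filter_plus_def by simp

lemma UNIV_positive: "UNIV \<in> positive_sets D"
  using D(1) unfolding positive_sets_def trivial_limit_def by simp

text \<open>A set positive for \<open>D + A\<close> meets \<open>A\<close> in a set positive for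
  \<open>D\<close>. This permits passing to a positive set of coordinates without changing
  \<open>lambda\<close>.\<close>

lemma constant_norm_filter_plus:
  assumes "A \<in> positive_sets D"
  shows "constant_norm (filter_plus D A) lam lambda"
proof
  show "filter_plus D A \<noteq> bot" "aleph1_complete (filter_plus D A)"
    using filter_plus_proper[OF assms] filter_plus_complete[OF D(2)] by auto
  fix B assume B: "B \<in> positive_sets (filter_plus D A)"
  have "A \<inter> B \<in> positive_sets D"
    using B unfolding positive_sets_def filter_plus_def eventually_inf_principal
    by (auto elim!: eventually_mono)
  moreover have "filter_plus (filter_plus D A) B = filter_plus D (A \<inter> B)"
    unfolding filter_plus_def by (simp add: inf_assoc)
  ultimately show "gh_norm (filter_plus (filter_plus D A) B) lam =o lambda" using norm by simp
qed (use lam large lambda in auto)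

lemma Lam_iso: "Lam =o lambda"
  using norm[OF UNIV_positive] unfolding filter_plus_UNIV Lam_def .

lemma norm_iso_Lam: "A \<in> positive_sets D \<Longrightarrow> gh_norm (filter_plus D A) lam =o Lam"
  using norm Lam_iso ordIso_symmetric ordIso_transitive by blast

lemma Lam_card: "Card_order Lam"
  using Card_order_ordIso[OF lambda Lam_iso] .

lemma wo_Lam: "Well_order Lam"
  using Lam_card by (rule card_order_on_well_order_on)

lemma pnorm_le:
  assumes "eventually (\<lambda>i. (g i, h i) \<in> lam i) D"
  shows "pnorm D g \<le>o pnorm D h"
  unfolding pnorm_def
  by (rule gh_norm_mono[OF D]) (use assms seg_le[OF wo_lam] in \<open>auto elim: eventually_mono\<close>)

lemma pnorm_le_filter_plus: "A \<in> positive_sets D \<Longrightarrow> pnorm D g \<le>o pnorm (filter_plus D A) g"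
  unfolding pnorm_def by (rule gh_norm_filter_plus[OF D])

lemma pnorm_less:
  assumes "E \<noteq> bot" "aleph1_complete E" "eventually (\<lambda>i. (g i, h i) \<in> lam i \<and> g i \<noteq> h i) E"
  shows "pnorm E g <o pnorm E h"
  unfolding pnorm_def
  by (rule gh_norm_strict_mono[OF assms(1,2)])
    (use assms(3) seg_less[OF wo_lam] in \<open>auto elim: eventually_mono\<close>)

lemma pnorm_less_Lam:
  assumes "A \<in> positive_sets D" "g \<in> points"
  shows "pnorm (filter_plus D A) g <o Lam"
proof -
  have "pnorm (filter_plus D A) g <o gh_norm (filter_plus D A) lam"
    unfolding pnorm_def
    by (rule gh_norm_strict_mono[OF filter_plus_proper[OF assms(1)] filter_plus_complete[OF D(2)]])
      (use assms(2) seg_less_self[OF wo_lam] in \<open>auto simp: points_def\<close>)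
  then show ?thesis using norm_iso_Lam[OF assms(1)] ordLess_ordIso_trans by blast
qed

lemma pnorm_less_Lam': "g \<in> points \<Longrightarrow> pnorm D g <o Lam"
  using pnorm_less_Lam[OF UNIV_positive] unfolding filter_plus_UNIV .

lemma Field_lam_ne: "\<exists>x. x \<in> Field (lam i)"
  using lam(2)[of i] unfolding cinfinite_def by (metis finite.emptyI ex_in_conv)

lemma pnorm_dense:
  fixes r :: "('k \<Rightarrow> 'a rel) rel"
  assumes "r <o Lam"
  shows "\<exists>g\<in>points. pnorm D g =o r"
proof -
  obtain h where h: "(h, lam) \<in> ord_less_mod D" "gh_norm D h =o r"
    using gh_norm_dense[OF D assms[unfolded Lam_def]] by blast
  \<comment> \<open>Almost everywhere the ordinal \<open>h i\<close> is below \<open>lam i\<close>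
    and is represented by a point; elsewhere any point serves.\<close>
  have "\<exists>x\<in>Field (lam i). h i <o lam i \<longrightarrow> h i =o seg (lam i) x" for i
    using ordLess_ex_seg[of "h i" "lam i"] Field_lam_ne by blast
  then obtain g where g: "\<And>i. g i \<in> Field (lam i)" "\<And>i. h i <o lam i \<Longrightarrow> h i =o seg (lam i) (g i)"
    by metis
  have ev: "eventually (\<lambda>i. h i <o lam i) D" using h(1) unfolding ord_less_mod_def by simp
  have "eventually (\<lambda>i. seg (lam i) (g i) \<le>o h i) D" "eventually (\<lambda>i. h i \<le>o seg (lam i) (g i)) D"
    using g(2) unfolding ordIso_iff_ordLeq by (blast intro: eventually_mono[OF ev])+
  then have "pnorm D g =o gh_norm D h"
    unfolding pnorm_def ordIso_iff_ordLeq by (intro conjI gh_norm_mono[OF D])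
  then show ?thesis using g(1) h(2) ordIso_transitive unfolding points_def by blast
qed

text \<open>Each \<open>a\<close> in \<open>r\<close> is sent to the norm of the function that
  represents the ordinal of \<open>a\<close> at every coordinate. Strict monotonicity of the norm
  makes this injective.\<close>

lemma card_le_Lam:
  assumes "Card_order r" "\<And>i. r \<le>o lam i"
  shows "r \<le>o Lam"
proof -
  have wr: "Well_order r" using assms(1) by (rule card_order_on_well_order_on)
  have "\<exists>x\<in>Field (lam i). seg r a =o seg (lam i) x" if "a \<in> Field r" for a i
    using ordLess_ex_seg ordLess_ordLeq_trans[OF seg_less_self[OF wr that] assms(2)] by blast
  then obtain e where e: "\<And>a i. a \<in> Field r \<Longrightarrow> e a i \<in> Field (lam i)"
    "\<And>a i. a \<in> Field r \<Longrightarrow> seg r a =o seg (lam i) (e a i)" by metis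
  have "\<exists>z\<in>Field Lam. pnorm D (e a) =o seg Lam z" if "a \<in> Field r" for a
    by (rule ordLess_ex_seg, rule pnorm_less_Lam') (use e(1) that in \<open>simp add: points_def\<close>)
  then obtain z where z: "\<And>a. a \<in> Field r \<Longrightarrow> z a \<in> Field Lam"
    "\<And>a. a \<in> Field r \<Longrightarrow> pnorm D (e a) =o seg Lam (z a)" by metis
  have less: "z a \<noteq> z b" if ab: "(a, b) \<in> r" "a \<noteq> b" for a b
  proof
    assume eq: "z a = z b"
    have F: "a \<in> Field r" "b \<in> Field r" using ab(1) unfolding Field_def by auto
    have "seg (lam i) (e a i) <o seg (lam i) (e b i)" for i
      using e(2)[OF F(1)] e(2)[OF F(2)] seg_less[OF wr ab] ordIso_ordLess_trans ordLess_ordIso_trans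
        ordIso_symmetric by blast
    then have "pnorm D (e a) <o pnorm D (e b)"
      unfolding pnorm_def by (intro gh_norm_strict_mono[OF D]) simp
    moreover have "pnorm D (e b) =o pnorm D (e a)"
      using z(2)[OF F(1)] z(2)[OF F(2)] eq ordIso_symmetric ordIso_transitive by metis
    ultimately show False using not_ordLess_ordIso ordIso_symmetric by blast
  qed
  have "inj_on z (Field r)"
    using less Well_order_less_or_le[OF wr] unfolding inj_on_def by metis
  then have "|Field r| \<le>o |Field Lam|" using card_of_ordLeq z(1) by blast
  then show ?thesis
    using card_of_Field_ordIso[OF assms(1)] card_of_Field_ordIso[OF Lam_card]
      ordIso_symmetric ordIso_ordLeq_trans ordLeq_ordIso_trans by blast
qed

lemma Lam_infinite: "Cinfinite Lam"
proof -
  have "natLeq \<le>o Lam"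
    by (rule card_le_Lam[OF natLeq_Card_order]) (use natLeq_ordLeq_cinfinite lam in blast)
  then show ?thesis using Lam_card cinfinite_mono[OF _ natLeq_cinfinite] by blast
qed

lemma Pow_le_Lam: "|UNIV :: 'k set set| \<le>o Lam"
  using card_le_Lam[OF card_of_Card_order] ordLess_imp_ordLeq[OF large] by blast

text \<open>By regularity \<open>X\<close> is not cofinal, which gives a weak bound
  \<open>a\<close>; an infinite cardinal has no last element, so a strict bound lies above
  \<open>a\<close>.\<close>

lemma lam_bounded:
  assumes "X \<subseteq> Field (lam i)" "|X| <o lam i"
  shows "\<exists>b\<in>Field (lam i). \<forall>x\<in>X. (x, b) \<in> lam i \<and> x \<noteq> b"
proof -
  have "\<not> cofinal X (lam i)"
    using assms lam(3)[of i] not_ordLess_ordIso unfolding regularCard_def by blast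
  then obtain a where a: "a \<in> Field (lam i)" "\<forall>x\<in>X. \<not> (a \<noteq> x \<and> (a, x) \<in> lam i)"
    unfolding cofinal_def by blast
  obtain b where b: "b \<in> Field (lam i)" "a \<noteq> b" "(a, b) \<in> lam i"
    using infinite_Card_order_limit[OF lam(1) _ a(1)] lam(2)[of i] unfolding cinfinite_def by blast
  have wr: "wo_rel (lam i)" using wo_lam unfolding wo_rel_def .
  have "(x, b) \<in> lam i \<and> x \<noteq> b" if x: "x \<in> X" for x
  proof -
    have "(x, a) \<in> lam i" using Well_order_less_or_le[OF wo_lam a(1), of x] a(2) x assms(1) by blast
    then show ?thesis
      using b wo_rel.TRANS[OF wr] wo_rel.ANTISYM[OF wr] unfolding trans_def antisym_def by metis
  qed
  then show ?thesis using b(1) by blast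
qed

text \<open>At each coordinate at most 2^\<kappa> values occur, fewer than the regular cardinal
  \<open>lam i\<close>.\<close>

lemma points_bounded:
  assumes "S \<subseteq> points" "|S| \<le>o |UNIV :: 'k set set|"
  shows "\<exists>b\<in>points. \<forall>g\<in>S. \<forall>i. (g i, b i) \<in> lam i"
proof -
  have "\<exists>b\<in>Field (lam i). \<forall>x\<in>(\<lambda>g. g i) ` S. (x, b) \<in> lam i \<and> x \<noteq> b" for i
  proof (rule lam_bounded)
    show "(\<lambda>g. g i) ` S \<subseteq> Field (lam i)" using assms(1) unfolding points_def by blast
    show "|(\<lambda>g. g i) ` S| <o lam i"
      using card_of_image assms(2) large ordLeq_transitive ordLeq_ordLess_trans by metis
  qed
  then obtain b where "\<And>i. b i \<in> Field (lam i)" "\<And>i g. g \<in> S \<Longrightarrow> (g i, b i) \<in> lam i"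
    by (metis imageI)
  then show ?thesis unfolding points_def by blast
qed

lemma lam_unbounded:
  assumes "X \<subseteq> Field (lam i)" "|X| =o lam i" "a \<in> Field (lam i)"
  shows "\<exists>x\<in>X. (a, x) \<in> lam i"
proof (rule ccontr)
  assume n: "\<not> (\<exists>x\<in>X. (a, x) \<in> lam i)"
  have "X \<subseteq> underS (lam i) a"
  proof
    fix x assume "x \<in> X"
    then show "x \<in> underS (lam i) a"
      using n Well_order_less_or_le[OF wo_lam _ assms(3), of x] assms(1) unfolding underS_def by blast
  qed
  then have "|X| <o lam i"
    using card_of_underS[OF lam(1) assms(3)] card_of_mono1 ordLeq_ordLess_trans by blast
  then show False using assms(2) not_ordLess_ordIso by blast
qed

section \<open>Coding by pairwise different functions\<close>

lemma card_same_norm: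
  assumes W: "W \<subseteq> points"
    and differ: "\<And>f g. f \<in> W \<Longrightarrow> g \<in> W \<Longrightarrow> f \<noteq> g \<Longrightarrow> eventually (\<lambda>i. f i \<noteq> g i) D"
    and same: "\<And>f g. f \<in> W \<Longrightarrow> g \<in> W \<Longrightarrow> pnorm D f =o pnorm D g"
  shows "|W| \<le>o Lam"
proof -
  \<comment> \<open>If \<open>f\<close> were below \<open>g\<close> everywhere, their being
    different almost everywhere would make the norm of \<open>f\<close> strictly smaller.\<close>
  have drop: "\<exists>i. (g i, f i) \<in> lam i \<and> g i \<noteq> f i" if fg: "f \<in> W" "g \<in> W" "f \<noteq> g" for f g
  proof (rule ccontr)
    assume n: "\<nexists>i. (g i, f i) \<in> lam i \<and> g i \<noteq> f i"
    have "(f i, g i) \<in> lam i" for i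
      using Well_order_less_or_le[OF wo_lam, of "g i" i "f i"] n W fg(1,2) unfolding points_def by blast
    then have "eventually (\<lambda>i. (f i, g i) \<in> lam i \<and> f i \<noteq> g i) D"
      using differ[OF fg] by (auto elim: eventually_mono)
    then show False using pnorm_less[OF D] same[OF fg(1,2)] not_ordLess_ordIso by blast
  qed
  \<comment> \<open>The colour of a pair is a coordinate at which the value drops from the first
    function to the second. An infinite increasing chain in \<open>|W|\<close> whose steps all have
    colour \<open>i\<close> would thus descend forever in \<open>lam i\<close>.\<close>
  define c where "c f g = (SOME i. (g i, f i) \<in> lam i \<and> g i \<noteq> f i)" for f g
  have c: "(g (c f g), f (c f g)) \<in> lam (c f g) \<and> g (c f g) \<noteq> f (c f g)"
    if "f \<in> W" "g \<in> W" "f \<noteq> g" for f g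
    unfolding c_def using someI_ex[OF drop[OF that]] .
  show ?thesis
  proof (rule card_of_ordLeq_by_colouring[OF card_of_well_order_on _ Lam_infinite Pow_le_Lam])
    fix i
    have wr: "wo_rel (lam i)" using wo_lam unfolding wo_rel_def .
    have "(g i, f i) \<in> lam i - Id" if "(f, g) \<in> |W|" "f \<noteq> g" "c f g = i" for f g
      using c[of f g] that FieldI1[OF that(1)] FieldI2[OF that(1)] by (simp only: Field_card_of) auto
    then show "wf {(g, f). (f, g) \<in> |W| \<and> f \<noteq> g \<and> c f g = i}"
      by (intro wf_subset[OF wf_inv_image[OF wo_rel.WF[OF wr], of "\<lambda>f. f i"]])
        (auto simp: inv_image_def)
  qed
qed

lemma ex_small_meeting_family:
  "\<exists>Z\<subseteq>points. |Z| \<le>o Lam \<and> (\<forall>h\<in>points. \<exists>z\<in>Z. {i. h i = z i} \<in> positive_sets D)"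
proof -
  define ad where "ad Z \<longleftrightarrow> Z \<subseteq> points \<and>
    (\<forall>f\<in>Z. \<forall>g\<in>Z. f \<noteq> g \<longrightarrow> eventually (\<lambda>i. f i \<noteq> g i) D)" for Z
  have "\<exists>Z\<in>{Z. ad Z}. \<forall>Y\<in>{Z. ad Z}. Z \<subseteq> Y \<longrightarrow> Y = Z"
  proof (rule Zorn_Lemma, rule ballI)
    fix C assume C: "C \<in> chains {Z. ad Z}"
    have ad: "ad Y" if "Y \<in> C" for Y using C that unfolding chains_def by blast
    have "eventually (\<lambda>i. f i \<noteq> g i) D" if fg: "f \<in> \<Union>C" "g \<in> \<Union>C" "f \<noteq> g" for f g
    proof -
      obtain X Y where XY: "f \<in> X" "X \<in> C" "g \<in> Y" "Y \<in> C" using fg(1,2) by blast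
      then consider "X \<subseteq> Y" | "Y \<subseteq> X" using C unfolding chains_def chain_subset_def by blast
      then show ?thesis using XY fg(3) ad unfolding ad_def by cases blast+
    qed
    then show "\<Union>C \<in> {Z. ad Z}" using ad unfolding ad_def by blast
  qed
  then obtain Z where Z: "ad Z" "\<And>Y. ad Y \<Longrightarrow> Z \<subseteq> Y \<Longrightarrow> Y = Z" by blast
  have pts: "Z \<subseteq> points" and differ: "\<And>f g. f \<in> Z \<Longrightarrow> g \<in> Z \<Longrightarrow> f \<noteq> g \<Longrightarrow> eventually (\<lambda>i. f i \<noteq> g i) D"
    using Z(1) unfolding ad_def by blast+
  have meet: "\<exists>z\<in>Z. {i. h i = z i} \<in> positive_sets D" if h: "h \<in> points" for h
  proof (rule ccontr)
    assume n: "\<not> (\<exists>z\<in>Z. {i. h i = z i} \<in> positive_sets D)"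
    have ev: "eventually (\<lambda>i. h i \<noteq> z i) D" "eventually (\<lambda>i. z i \<noteq> h i) D" if "z \<in> Z" for z
      using n that unfolding positive_sets_def by (auto elim!: eventually_mono)
    then have "ad (insert h Z)" using pts differ h unfolding ad_def by blast
    then have "h \<in> Z" using Z(2)[of "insert h Z"] by blast
    then show False using ev(1)[of h] D(1) by (simp add: trivial_limit_def)
  qed
  \<comment> \<open>\<open>Z\<close> splits by norm into at most \<open>Lam\<close> classes, each of
    size at most \<open>Lam\<close> by \<open>card_same_norm\<close>.\<close>
  let ?Y = "\<lambda>r. {z \<in> Z. pnorm D z =o seg Lam r}"
  have "Z = (\<Union>r\<in>Field Lam. ?Y r)"
    using ordLess_ex_seg[OF pnorm_less_Lam'] pts by blast
  moreover have "|\<Union>r\<in>Field Lam. ?Y r| \<le>o Lam"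
  proof (rule card_of_UNION_ordLeq_infinite_Field)
    show "infinite (Field Lam)" "Card_order Lam" using Lam_infinite unfolding cinfinite_def by auto
    show "|Field Lam| \<le>o Lam" using card_of_Field_ordIso[OF Lam_card] ordIso_iff_ordLeq by blast
    show "\<forall>r\<in>Field Lam. |?Y r| \<le>o Lam"
    proof
      fix r
      have "pnorm D f =o pnorm D g" if "f \<in> ?Y r" "g \<in> ?Y r" for f g
        using that ordIso_symmetric ordIso_transitive by blast
      then show "|?Y r| \<le>o Lam" using pts differ by (intro card_same_norm) blast+
    qed
  qed
  ultimately have "|Z| \<le>o Lam" by simp
  then show ?thesis using pts meet by blast
qed

section \<open>From almost disjoint families on the \<open>lam i\<close> to one on
  \<open>lambda\<close>\<close>

lemma almost_disjoint_transfer: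
  fixes X :: "'i \<Rightarrow> 'k \<Rightarrow> 'a set"
  assumes X: "\<And>\<alpha> i. \<alpha> \<in> I \<Longrightarrow> X \<alpha> i \<subseteq> Field (lam i)" "\<And>\<alpha> i. \<alpha> \<in> I \<Longrightarrow> |X \<alpha> i| =o lam i"
    and disj: "\<And>\<alpha> \<beta>. \<alpha> \<in> I \<Longrightarrow> \<beta> \<in> I \<Longrightarrow> \<alpha> \<noteq> \<beta> \<Longrightarrow> eventually (\<lambda>i. |X \<alpha> i \<inter> X \<beta> i| <o lam i) D"
  shows "\<exists>P. almost_disjoint_family lambda P \<and> |I| =o |P|"
proof -
  obtain Z where Z: "Z \<subseteq> points" "|Z| \<le>o Lam"
    "\<forall>h\<in>points. \<exists>z\<in>Z. {i. h i = z i} \<in> positive_sets D"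
    using ex_small_meeting_family by blast
  obtain rep where rep: "\<And>h. h \<in> points \<Longrightarrow> rep h \<in> Z"
    "\<And>h. h \<in> points \<Longrightarrow> {i. h i = rep h i} \<in> positive_sets D"
    using Z(3) by metis
  have "\<exists>g\<in>points. pnorm D g =o seg Lam \<zeta>" if "\<zeta> \<in> Field Lam" for \<zeta>
    using pnorm_dense[OF seg_less_self[OF wo_Lam that]] .
  then obtain g where g: "\<And>\<zeta>. \<zeta> \<in> Field Lam \<Longrightarrow> g \<zeta> \<in> points"
    "\<And>\<zeta>. \<zeta> \<in> Field Lam \<Longrightarrow> pnorm D (g \<zeta>) =o seg Lam \<zeta>" by metis
  have "\<exists>x\<in>X \<alpha> i. (g \<zeta> i, x) \<in> lam i" if "\<alpha> \<in> I" "\<zeta> \<in> Field Lam" for \<alpha> \<zeta> i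
    using lam_unbounded[OF X[OF that(1)]] g(1)[OF that(2)] unfolding points_def by blast
  then obtain h where h: "\<And>\<alpha> \<zeta> i. \<alpha> \<in> I \<Longrightarrow> \<zeta> \<in> Field Lam \<Longrightarrow> h \<alpha> \<zeta> i \<in> X \<alpha> i"
    "\<And>\<alpha> \<zeta> i. \<alpha> \<in> I \<Longrightarrow> \<zeta> \<in> Field Lam \<Longrightarrow> (g \<zeta> i, h \<alpha> \<zeta> i) \<in> lam i" by metis
  have hp: "h \<alpha> \<zeta> \<in> points" if "\<alpha> \<in> I" "\<zeta> \<in> Field Lam" for \<alpha> \<zeta>
    using h(1)[OF that] X(1)[OF that(1)] unfolding points_def by blast
  \<comment> \<open>Recording the set of agreement matters: if two codes coincide, both functions
    agree with the same member of \<open>Z\<close> on the same positive set, hence with each other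
    there.\<close>
  define F where "F \<alpha> \<zeta> = (rep (h \<alpha> \<zeta>), {i. h \<alpha> \<zeta> i = rep (h \<alpha> \<zeta>) i})" for \<alpha> \<zeta>
  have few: "|{\<zeta> \<in> Field Lam. F \<alpha> \<zeta> = F \<beta> \<zeta>}| <o Lam" if I: "\<alpha> \<in> I" "\<beta> \<in> I" "\<alpha> \<noteq> \<beta>" for \<alpha> \<beta>
  proof -
    have "\<exists>b\<in>Field (lam i). |X \<alpha> i \<inter> X \<beta> i| <o lam i \<longrightarrow> (\<forall>x\<in>X \<alpha> i \<inter> X \<beta> i. (x, b) \<in> lam i \<and> x \<noteq> b)" for i
      using lam_bounded[of "X \<alpha> i \<inter> X \<beta> i" i] X(1)[OF I(1)] Field_lam_ne by blast
    then obtain b where b: "\<And>i. b i \<in> Field (lam i)"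
      "\<And>i x. |X \<alpha> i \<inter> X \<beta> i| <o lam i \<Longrightarrow> x \<in> X \<alpha> i \<inter> X \<beta> i \<Longrightarrow> (x, b i) \<in> lam i \<and> x \<noteq> b i"
      by metis
    have bp: "b \<in> points" using b(1) unfolding points_def by blast
    \<comment> \<open>The norms of \<open>b\<close> modulo the various \<open>D + A\<close> are
      realised modulo \<open>D\<close> itself by functions \<open>p A\<close>. There are at most
      2^\<kappa> of these, so a single \<open>q\<close> dominates them, and its norm bounds all
      these ordinals below \<open>Lam\<close>.\<close>
    have "\<exists>p\<in>points. pnorm D p =o pnorm (filter_plus D A) b" if "A \<in> positive_sets D" for A
      using pnorm_dense[OF pnorm_less_Lam[OF that bp]] .
    then obtain p where p: "\<And>A. A \<in> positive_sets D \<Longrightarrow> p A \<in> points"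
      "\<And>A. A \<in> positive_sets D \<Longrightarrow> pnorm D (p A) =o pnorm (filter_plus D A) b" by metis
    have "|p ` positive_sets D| \<le>o |UNIV :: 'k set set|"
      using card_of_image card_of_mono1[OF subset_UNIV] ordLeq_transitive by blast
    then obtain q where q: "q \<in> points" "\<And>A i. A \<in> positive_sets D \<Longrightarrow> (p A i, q i) \<in> lam i"
      using points_bounded[of "p ` positive_sets D"] p(1) by blast
    obtain \<xi> where \<xi>: "\<xi> \<in> Field Lam" "pnorm D q =o seg Lam \<xi>"
      using ordLess_ex_seg[OF pnorm_less_Lam'[OF q(1)]] by blast
    have "\<zeta> \<in> underS Lam \<xi>" if \<zeta>: "\<zeta> \<in> Field Lam" "F \<alpha> \<zeta> = F \<beta> \<zeta>" for \<zeta>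
    proof -
      define A where "A = {i. h \<alpha> \<zeta> i = rep (h \<alpha> \<zeta>) i}"
      have A: "A \<in> positive_sets D" using rep(2)[OF hp[OF I(1) \<zeta>(1)]] unfolding A_def .
      note E = filter_plus_proper[OF A] filter_plus_complete[OF D(2), of A]
      have reps: "rep (h \<alpha> \<zeta>) = rep (h \<beta> \<zeta>)" and A_eq: "A = {i. h \<beta> \<zeta> i = rep (h \<beta> \<zeta>) i}"
        using \<zeta>(2) unfolding F_def A_def prod.inject by blast+
      have "h \<alpha> \<zeta> i = h \<beta> \<zeta> i" if "i \<in> A" for i
      proof -
        have "h \<alpha> \<zeta> i = rep (h \<alpha> \<zeta>) i" using that unfolding A_def by simp
        moreover have "h \<beta> \<zeta> i = rep (h \<beta> \<zeta>) i" using that unfolding A_eq by simp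
        ultimately show ?thesis using reps by simp
      qed
      then have "h \<alpha> \<zeta> i \<in> X \<alpha> i \<inter> X \<beta> i" if "i \<in> A" for i
        using h(1)[OF I(1) \<zeta>(1)] h(1)[OF I(2) \<zeta>(1)] that by (metis IntI)
      then have "eventually (\<lambda>i. (h \<alpha> \<zeta> i, b i) \<in> lam i \<and> h \<alpha> \<zeta> i \<noteq> b i) (filter_plus D A)"
        using disj[OF I] b(2) unfolding filter_plus_def eventually_inf_principal
        by (auto elim!: eventually_mono)
      then have less: "pnorm (filter_plus D A) (h \<alpha> \<zeta>) <o pnorm (filter_plus D A) b"
        by (rule pnorm_less[OF E])
      have "seg Lam \<zeta> \<le>o pnorm D (g \<zeta>)" using g(2)[OF \<zeta>(1)] ordIso_iff_ordLeq by blast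
      also have "pnorm D (g \<zeta>) \<le>o pnorm D (h \<alpha> \<zeta>)"
        by (rule pnorm_le) (simp add: h(2)[OF I(1) \<zeta>(1)])
      also have "pnorm D (h \<alpha> \<zeta>) \<le>o pnorm (filter_plus D A) (h \<alpha> \<zeta>)"
        by (rule pnorm_le_filter_plus[OF A])
      also have "pnorm (filter_plus D A) (h \<alpha> \<zeta>) <o pnorm (filter_plus D A) b" by (rule less)
      also have "pnorm (filter_plus D A) b \<le>o pnorm D (p A)" using p(2)[OF A] ordIso_iff_ordLeq by blast
      also have "pnorm D (p A) \<le>o pnorm D q" by (rule pnorm_le) (simp add: q(2)[OF A])
      also have "pnorm D q =o seg Lam \<xi>" by (rule \<xi>(2))
      finally show ?thesis by (rule seg_less_imp_underS[OF wo_Lam \<zeta>(1) \<xi>(1)])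
    qed
    then have "{\<zeta> \<in> Field Lam. F \<alpha> \<zeta> = F \<beta> \<zeta>} \<subseteq> underS Lam \<xi>" by blast
    then show ?thesis using card_of_underS[OF Lam_card \<xi>(1)] card_of_mono1 ordLeq_ordLess_trans by blast
  qed
  have "|(Z \<times> (UNIV :: 'k set set)) \<times> Field Lam| \<le>o Lam"
    using Lam_infinite Z(2) Pow_le_Lam card_of_Field_ordIso[OF Lam_card]
    by (intro card_of_Times_ordLeq_infinite_Field) (auto simp: cinfinite_def ordIso_iff_ordLeq)
  also have "Lam =o |Field lambda|"
    using Lam_iso card_of_Field_ordIso[OF lambda] ordIso_symmetric ordIso_transitive by blast
  finally obtain j where j: "inj_on j ((Z \<times> (UNIV :: 'k set set)) \<times> Field Lam)"
    "j ` ((Z \<times> (UNIV :: 'k set set)) \<times> Field Lam) \<subseteq> Field lambda"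
    unfolding card_of_ordLeq[symmetric] by blast
  define B where "B \<alpha> = (\<lambda>\<zeta>. (F \<alpha> \<zeta>, \<zeta>)) ` Field Lam" for \<alpha>
  have B: "B \<alpha> \<subseteq> (Z \<times> UNIV) \<times> Field Lam" if "\<alpha> \<in> I" for \<alpha>
    using rep(1) hp[OF that] unfolding B_def F_def by auto
  have card_j: "|j ` S| =o |S|" if "S \<subseteq> (Z \<times> UNIV) \<times> Field Lam" for S
    using card_of_ordIso[of S "j ` S"] ordIso_symmetric inj_on_subset[OF j(1) that]
    unfolding bij_betw_def by blast
  have jB: "|j ` B \<alpha>| =o lambda" if "\<alpha> \<in> I" for \<alpha>
  proof -
    have "inj_on (\<lambda>\<zeta>. (F \<alpha> \<zeta>, \<zeta>)) (Field Lam)" by (simp add: inj_on_def)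
    then have "|Field Lam| =o |B \<alpha>|" unfolding B_def card_of_ordIso[symmetric] bij_betw_def by blast
    then have BF: "|B \<alpha>| =o |Field Lam|" by (rule ordIso_symmetric)
    note card_j[OF B[OF that]]
    also note BF
    also note card_of_Field_ordIso[OF Lam_card]
    also note Lam_iso
    finally show ?thesis .
  qed
  have jBB: "|j ` B \<alpha> \<inter> j ` B \<beta>| <o lambda" if I: "\<alpha> \<in> I" "\<beta> \<in> I" "\<alpha> \<noteq> \<beta>" for \<alpha> \<beta>
  proof -
    have "j ` B \<alpha> \<inter> j ` B \<beta> = j ` (B \<alpha> \<inter> B \<beta>)"
      using inj_on_image_Int[OF j(1) B B] I by simp
    also have "B \<alpha> \<inter> B \<beta> = (\<lambda>\<zeta>. (F \<alpha> \<zeta>, \<zeta>)) ` {\<zeta> \<in> Field Lam. F \<alpha> \<zeta> = F \<beta> \<zeta>}"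
      unfolding B_def image_def by auto
    finally have eq: "j ` B \<alpha> \<inter> j ` B \<beta> =
      j ` (\<lambda>\<zeta>. (F \<alpha> \<zeta>, \<zeta>)) ` {\<zeta> \<in> Field Lam. F \<alpha> \<zeta> = F \<beta> \<zeta>}" .
    have "|j ` B \<alpha> \<inter> j ` B \<beta>| \<le>o |{\<zeta> \<in> Field Lam. F \<alpha> \<zeta> = F \<beta> \<zeta>}|"
      unfolding eq by (rule ordLeq_transitive[OF card_of_image card_of_image])
    also note few[OF I]
    also note Lam_iso
    finally show ?thesis .
  qed
  have "inj_on (\<lambda>\<alpha>. j ` B \<alpha>) I"
  proof (rule inj_onI, rule ccontr)
    fix \<alpha> \<beta> assume *: "\<alpha> \<in> I" "\<beta> \<in> I" "j ` B \<alpha> = j ` B \<beta>" "\<alpha> \<noteq> \<beta>"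
    have "|j ` B \<beta>| <o lambda" using jBB[OF *(1,2,4)] unfolding *(3) by simp
    then show False using jB[OF *(2)] not_ordLess_ordIso by blast
  qed
  then have "|I| =o |(\<lambda>\<alpha>. j ` B \<alpha>) ` I|" unfolding card_of_ordIso[symmetric] bij_betw_def by blast
  moreover have "almost_disjoint_family lambda ((\<lambda>\<alpha>. j ` B \<alpha>) ` I)"
  proof -
    have "j ` B \<alpha> \<subseteq> Field lambda" if "\<alpha> \<in> I" for \<alpha> using B[OF that] j(2) by blast
    then show ?thesis using jB jBB unfolding almost_disjoint_family_def by blast
  qed
  ultimately show ?thesis by blast
qed

end

section \<open>Increasing sequences\<close>

text \<open>Subfamilies of almost disjoint families are almost disjoint: if \<open>nu\<close> were
  at least \<open>ad_number chi\<close>, then \<open>P\<close> would contain a family of exactly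
  that size.\<close>

lemma less_ad_numberI:
  assumes "almost_disjoint_family chi P" "Card_order nu" "nu \<le>o |P|"
  shows "nu <o ad_number chi"
proof (rule ccontr)
  note ad = ad_number_props[where chi = chi]
  assume "\<not> nu <o ad_number chi"
  then have "ad_number chi \<le>o nu"
    using ordLess_or_ordLeq[OF card_order_on_well_order_on[OF assms(2)] card_order_on_well_order_on[OF ad(1)]]
    by simp
  then have "|Field (ad_number chi)| \<le>o |P|"
    using assms(3) card_of_Field_ordIso[OF ad(1)] ordIso_ordLeq_trans ordLeq_transitive by blast
  then obtain f where f: "inj_on f (Field (ad_number chi))" "f ` Field (ad_number chi) \<subseteq> P"
    unfolding card_of_ordLeq[symmetric] by blast
  let ?Q = "f ` Field (ad_number chi)"
  have "almost_disjoint_family chi ?Q"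
    using assms(1) f(2) unfolding almost_disjoint_family_def by blast
  moreover have "|Field (ad_number chi)| =o |?Q|"
    using f(1) unfolding card_of_ordIso[symmetric] bij_betw_def by blast
  then have "|?Q| =o ad_number chi"
    using card_of_Field_ordIso[OF ad(1)] ordIso_symmetric ordIso_transitive by blast
  ultimately show False using ad(2) by blast
qed

lemma less_ad_numberD:
  fixes chi :: "'a rel"
  assumes "Card_order nu" "nu <o ad_number chi"
  shows "\<exists>P. almost_disjoint_family chi P \<and> |P| =o nu"
proof (rule ccontr)
  assume n: "\<nexists>P. almost_disjoint_family chi P \<and> |P| =o nu"
  \<comment> \<open>Minimality of \<open>ad_number chi\<close> concerns cardinals on its own type,
    so \<open>nu\<close> is first replaced by a copy there, which exists because \<open>nu\<close>
    is smaller.\<close>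
  obtain p :: "'a set set rel" where p: "nu =o p" "p <o ad_number chi"
    using assms(2) internalize_ordLess[of nu "ad_number chi"] by blast
  have "\<nexists>P. almost_disjoint_family chi P \<and> |P| =o p"
    using n p(1) ordIso_symmetric ordIso_transitive by blast
  then have "ad_number chi \<le>o p" using ad_number_props(3) Card_order_ordIso2[OF assms(1) p(1)] by blast
  then show False using p(2) not_ordLess_ordLeq by blast
qed

lemma less_depth_plusD:
  fixes S :: "'b set"
  assumes irrefl: "\<And>x. x \<in> S \<Longrightarrow> \<not> lt x x" and "Card_order nu" "nu <o depth_plus S lt"
  shows "\<exists>(chi :: 'b set rel) s. Card_order chi \<and> nu =o chi \<and> increasing_seq S lt chi s"
proof -
  obtain chi :: "'b set rel" where chi: "nu =o chi" "chi <o depth_plus S lt"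
    using assms(3) internalize_ordLess[of nu "depth_plus S lt"] by blast
  have c: "Card_order chi" using Card_order_ordIso2[OF assms(2) chi(1)] .
  have "\<exists>s. increasing_seq S lt chi s"
  proof (rule ccontr)
    assume "\<nexists>s. increasing_seq S lt chi s"
    with irrefl c have "depth_plus S lt \<le>o chi" by (rule depth_plus_props(3))
    then show False using chi(2) not_ordLess_ordLeq by blast
  qed
  then show ?thesis using c chi(1) by blast
qed

section \<open>Increasing sequences from true cofinality\<close>

definition no_max :: "('k \<Rightarrow> 'm rel) \<Rightarrow> 'k set" where
  "no_max mu = {i. \<forall>x\<in>Field (mu i). \<exists>y\<in>Field (mu i). (x, y) \<in> mu i \<and> x \<noteq> y}"

text \<open>
  No successors exist at coordinates where \<open>mu i\<close> has a maximum, so there a cofinal sequence need not increase strictly; hence the restriction to \<^const>\<open>no_max\<close>.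
\<close>

lemma has_tcf_increasing_seq:
  fixes mu :: "'k \<Rightarrow> 'm rel"
  assumes mu: "\<And>i. Well_order (mu i)" and tcf: "has_tcf (card_prod mu) (le_mod D mu) mu0"
  shows "\<exists>s. increasing_seq (card_prod mu) (less_mod (filter_plus D (no_max mu)) mu) mu0 s"
proof -
  let ?S = "card_prod mu" and ?E = "filter_plus D (no_max mu)"
  have tr: "(x, y) \<in> mu i \<Longrightarrow> (y, z) \<in> mu i \<Longrightarrow> (x, z) \<in> mu i"
    and asym: "(x, y) \<in> mu i \<Longrightarrow> (y, x) \<in> mu i \<Longrightarrow> x = y" for x y z i
    using wo_rel.TRANS[of "mu i"] wo_rel.ANTISYM[of "mu i"] mu[of i]
    unfolding wo_rel_def trans_def antisym_def by blast+
  have le_tr: "le_mod D mu f h" if "le_mod D mu f g" "le_mod D mu g h" for f g h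
    using that unfolding le_mod_def by eventually_elim (rule tr)
  obtain C where C: "linear_cofinal ?S (le_mod D mu) C"
    and least: "\<And>C. linear_cofinal ?S (le_mod D mu) C \<Longrightarrow> mu0 \<le>o |C|"
    and c0: "Card_order mu0"
    using tcf unfolding has_tcf_def by blast
  \<comment> \<open>A set of fewer than \<open>mu0\<close> members is not cofinal, so some
    \<open>f\<close> lies below none of them; by linearity any \<open>c\<close> in \<open>C\<close>
    above \<open>f\<close> is above them all. Raising \<open>c\<close> strictly on
    \<open>no_max mu\<close> and returning to \<open>C\<close> makes the bound strict.\<close>
  have bound: "\<exists>c\<in>C. \<forall>t\<in>T. less_mod ?E mu t c" if T: "T \<subseteq> C" "|T| <o mu0" for T
  proof -
    have "\<not> linear_cofinal ?S (le_mod D mu) T" using least T(2) not_ordLess_ordLeq by blast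
    then obtain f where f: "f \<in> ?S" "\<And>t. t \<in> T \<Longrightarrow> \<not> le_mod D mu f t"
      using C T(1) unfolding linear_cofinal_def by blast
    then obtain c where c: "c \<in> C" "le_mod D mu f c" using C unfolding linear_cofinal_def by blast
    have tc: "le_mod D mu t c" if "t \<in> T" for t
      using C T(1) c le_tr f(2) that unfolding linear_cofinal_def by blast
    have cS: "c i \<in> Field (mu i)" for i
      using C c(1) unfolding linear_cofinal_def card_prod_def by blast
    have "\<exists>y\<in>Field (mu i). i \<in> no_max mu \<longrightarrow> (c i, y) \<in> mu i \<and> c i \<noteq> y" for i
      using cS[of i] unfolding no_max_def by blast
    then obtain d where d: "\<And>i. d i \<in> Field (mu i)"
      "\<And>i. i \<in> no_max mu \<Longrightarrow> (c i, d i) \<in> mu i \<and> c i \<noteq> d i" by metis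
    have "d \<in> ?S" using d(1) unfolding card_prod_def by blast
    then obtain e where e: "e \<in> C" "le_mod D mu d e" using C unfolding linear_cofinal_def by blast
    have "less_mod ?E mu t e" if "t \<in> T" for t
      using tc[OF that] e(2)
      unfolding less_mod_def le_mod_def filter_plus_def eventually_inf_principal
    proof (rule eventually_elim2, intro impI)
      fix i assume i: "(t i, c i) \<in> mu i" "(d i, e i) \<in> mu i" "i \<in> no_max mu"
      have "(t i, e i) \<in> mu i" using tr tr i d(2) by blast
      moreover have "t i \<noteq> e i" using asym[of "c i" "d i" i] tr[OF i(2)] i d(2) by metis
      ultimately show "(t i, e i) \<in> mu i \<and> t i \<noteq> e i" by simp
    qed
    then show ?thesis using e(1) by blast
  qed
  have w0: "Well_order mu0" using c0 by (rule card_order_on_well_order_on)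
  have wf: "wf (mu0 - Id)" using w0 unfolding well_order_on_def by blast
  \<comment> \<open>Each stage of the recursion has fewer than \<open>mu0\<close> predecessors, so
    \<open>bound\<close> will supply the next value.\<close>
  define s where "s = wfrec (mu0 - Id)
    (\<lambda>s a. SOME c. c \<in> C \<and> (\<forall>t\<in>s ` underS mu0 a. less_mod ?E mu t c))"
  have s: "s a = (SOME c. c \<in> C \<and> (\<forall>t\<in>s ` underS mu0 a. less_mod ?E mu t c))" for a
  proof -
    have "cut s (mu0 - Id) a ` underS mu0 a = s ` underS mu0 a"
      by (rule image_cong) (auto simp: cut_apply underS_def)
    then show ?thesis unfolding s_def by (subst wfrec[OF wf]) (simp only:)
  qed
  have main: "a \<in> Field mu0 \<longrightarrow> s a \<in> C \<and> (\<forall>t\<in>s ` underS mu0 a. less_mod ?E mu t (s a))" for a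
  proof (induction a rule: wf_induct_rule[OF wf])
    case (1 a)
    show ?case
    proof
      assume a: "a \<in> Field mu0"
      have "s ` underS mu0 a \<subseteq> C"
        using 1 by (auto simp: underS_def Field_def)
      moreover have "|s ` underS mu0 a| <o mu0"
        using card_of_underS[OF c0 a] card_of_image ordLeq_ordLess_trans by blast
      ultimately have "\<exists>c. c \<in> C \<and> (\<forall>t\<in>s ` underS mu0 a. less_mod ?E mu t c)" using bound by blast
      then show "s a \<in> C \<and> (\<forall>t\<in>s ` underS mu0 a. less_mod ?E mu t (s a))"
        unfolding s[of a] by (rule someI_ex)
    qed
  qed
  have "increasing_seq ?S (less_mod ?E mu) mu0 s"
    unfolding increasing_seq_def
  proof (intro conjI ballI allI impI)
    show "s a \<in> ?S" if "a \<in> Field mu0" for a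
      using main that C unfolding linear_cofinal_def by blast
    show "less_mod ?E mu (s a) (s b)" if "(a, b) \<in> mu0 \<and> a \<noteq> b" for a b
      using main[of b] that FieldI2[of a b mu0] unfolding underS_def by blast
  qed
  then show ?thesis by blast
qed

text \<open>Almost every \<open>mu i\<close> has a maximum, so the function of maxima is cofinal by
  itself; if the product is empty, the empty set is.\<close>

lemma has_tcf_le_singleton:
  fixes mu :: "'k \<Rightarrow> 'm rel"
  assumes mu: "\<And>i. Well_order (mu i)" and tcf: "has_tcf (card_prod mu) (le_mod D mu) mu0"
    and max: "no_max mu \<notin> positive_sets D"
  shows "mu0 \<le>o |{x}|"
proof -
  have "\<exists>C m. linear_cofinal (card_prod mu) (le_mod D mu) C \<and> C \<subseteq> {m}"
  proof (cases "card_prod mu = {}")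
    case True
    then show ?thesis unfolding linear_cofinal_def by blast
  next
    case False
    have "\<exists>m\<in>Field (mu i). i \<notin> no_max mu \<longrightarrow> (\<forall>x\<in>Field (mu i). (x, m) \<in> mu i)" for i
    proof (cases "i \<in> no_max mu")
      case True
      then show ?thesis using False unfolding card_prod_def by blast
    next
      case n: False
      then show ?thesis using Well_order_less_or_le[OF mu] unfolding no_max_def by blast
    qed
    then obtain m where m: "\<And>i. m i \<in> Field (mu i)"
      "\<And>i x. i \<notin> no_max mu \<Longrightarrow> x \<in> Field (mu i) \<Longrightarrow> (x, m i) \<in> mu i" by metis
    have "eventually (\<lambda>i. i \<notin> no_max mu) D" using max unfolding positive_sets_def by simp
    then have "le_mod D mu f m" if "f \<in> card_prod mu" for f
      unfolding le_mod_def using m(2) that by (auto simp: card_prod_def elim!: eventually_mono)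
    moreover have "m \<in> card_prod mu" using m(1) unfolding card_prod_def by blast
    ultimately have "linear_cofinal (card_prod mu) (le_mod D mu) {m}"
      unfolding linear_cofinal_def by blast
    then show ?thesis by blast
  qed
  then obtain C m where C: "linear_cofinal (card_prod mu) (le_mod D mu) C" "C \<subseteq> {m}" by blast
  have "|C| \<le>o |{x}|"
    unfolding card_of_ordLeq[symmetric] using C(2) by (intro exI[of _ "\<lambda>_. x"]) (auto intro: inj_onI)
  then show ?thesis using tcf C(1) ordLeq_transitive unfolding has_tcf_def by blast
qed

text \<open>Each \<open>s a i\<close> serves as an index into a family of \<open>mu i\<close> almost
  disjoint sets. Two terms of the sequence differ at almost all coordinates, hence so do the chosen
  sets.\<close>

lemma (in constant_norm) increasing_seq_almost_disjoint:
  assumes mu: "\<And>i. Card_order (mu i)" "\<And>i. mu i <o ad_number (lam i)"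
    and chi: "Card_order chi" and s: "increasing_seq (card_prod mu) (less_mod D mu) chi s"
  shows "chi <o ad_number lambda"
proof -
  have "\<exists>P b. almost_disjoint_family (lam i) P \<and> bij_betw b (Field (mu i)) P" for i
  proof -
    obtain P where P: "almost_disjoint_family (lam i) P" "|P| =o mu i"
      using less_ad_numberD[OF mu] by blast
    then have "|Field (mu i)| =o |P|"
      using card_of_Field_ordIso[OF mu(1)] ordIso_symmetric ordIso_transitive by blast
    then show ?thesis using P(1) unfolding card_of_ordIso[symmetric] by blast
  qed
  then obtain P b where P: "\<And>i. almost_disjoint_family (lam i) (P i)"
    and b: "\<And>i. bij_betw (b i) (Field (mu i)) (P i)" by metis
  have sF: "s a i \<in> Field (mu i)" if "a \<in> Field chi" for a i
    using s that unfolding increasing_seq_def card_prod_def by blast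
  have bP: "b i (s a i) \<in> P i" if "a \<in> Field chi" for a i
    using bij_betwE[OF b] sF[OF that] by blast
  have "eventually (\<lambda>i. |b i (s a i) \<inter> b i (s a' i)| <o lam i) D"
    if a: "a \<in> Field chi" "a' \<in> Field chi" "a \<noteq> a'" for a a'
  proof -
    have "less_mod D mu (s a) (s a') \<or> less_mod D mu (s a') (s a)"
      using s Well_order_less_or_le[OF card_order_on_well_order_on[OF chi] a(1,2)] a(3)
      unfolding increasing_seq_def by blast
    then have "eventually (\<lambda>i. s a i \<noteq> s a' i) D"
      unfolding less_mod_def by (auto elim: eventually_mono)
    then show ?thesis
    proof (rule eventually_mono)
      fix i assume "s a i \<noteq> s a' i"
      then have "b i (s a i) \<noteq> b i (s a' i)"
        using bij_betw_imp_inj_on[OF b, of i] sF a(1,2) unfolding inj_on_def by blast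
      then show "|b i (s a i) \<inter> b i (s a' i)| <o lam i"
        using P[of i] bP a(1,2) unfolding almost_disjoint_family_def by blast
    qed
  qed
  moreover have "b i (s a i) \<subseteq> Field (lam i)" "|b i (s a i)| =o lam i" if "a \<in> Field chi" for a i
    using P[of i] bP[OF that, of i] unfolding almost_disjoint_family_def by blast+
  ultimately obtain Q where Q: "almost_disjoint_family lambda Q" and "|Field chi| =o |Q|"
    using almost_disjoint_transfer[of "Field chi" "\<lambda>a i. b i (s a i)"] by blast
  then have "chi \<le>o |Q|"
    using ordIso_ordLeq_trans[OF ordIso_symmetric[OF card_of_Field_ordIso[OF chi]]] ordIso_iff_ordLeq by blast
  then show ?thesis using less_ad_numberI Q chi by blast
qed

lemma Pow_ordIso_ctwo_cexp: "|UNIV :: 'k set set| =o ctwo ^c |UNIV :: 'k set|"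
  using card_of_Pow_Func[of "UNIV :: 'k set"] unfolding cexp_def ctwo_def Field_card_of by simp

theorem theorem5:
  fixes D :: "'k filter"
    and lam :: "'k \<Rightarrow> 'a rel" and lambda :: "'l rel"
    and mu :: "'k \<Rightarrow> 'm rel" and mu0 :: "'n rel"
  assumes "D \<noteq> bot" and "aleph1_complete D"
    and "\<And>i. Card_order (lam i) \<and> cinfinite (lam i) \<and> regularCard (lam i)"
    and "\<And>i. cardSuc (ctwo ^c |UNIV :: 'k set| ) <o lam i"
    and "Card_order lambda"
    and "\<And>A. A \<in> positive_sets D \<Longrightarrow> gh_norm (filter_plus D A) lam =o lambda"
    and "\<And>i. Card_order (mu i)" and "\<And>i. mu i <o ad_number (lam i)"
    and "Card_order mu0"
    and "has_tcf (card_prod mu) (le_mod D mu) mu0 \<or>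
         (mu0 <o depth_plus (card_prod mu) (less_mod D mu) \<and> ctwo ^c |UNIV :: 'k set| <o mu0)"
  shows "mu0 <o ad_number lambda"
proof -
  have "|UNIV :: 'k set set| <o lam i" for i
    using Pow_ordIso_ctwo_cexp cardSuc_greater[OF Card_order_cexp] assms(4)[of i]
      ordIso_ordLess_trans ordLess_transitive by blast
  then interpret constant_norm D lam lambda
    using assms(1-6) by unfold_locales auto
  note wo_mu = card_order_on_well_order_on[OF assms(7)]
  show ?thesis
  proof (cases "has_tcf (card_prod mu) (le_mod D mu) mu0")
    case tcf: True
    show ?thesis
    \<comment> \<open>The strictly increasing sequence is obtained modulo
      \<open>D + no_max mu\<close>; if \<open>no_max mu\<close> is positive, this filter has the
      same constant norm \<open>lambda\<close>. Otherwise \<open>mu0\<close> is at most 1 and a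
      single set suffices.\<close>
    proof (cases "no_max mu \<in> positive_sets D")
      case True
      then interpret N: constant_norm "filter_plus D (no_max mu)" lam lambda
        by (rule constant_norm_filter_plus)
      show ?thesis
        using has_tcf_increasing_seq[OF wo_mu tcf] N.increasing_seq_almost_disjoint[OF assms(7,8,9)] by blast
    next
      case False
      have "almost_disjoint_family lambda {Field lambda}"
        using card_of_Field_ordIso[OF assms(5)] unfolding almost_disjoint_family_def by blast
      then show ?thesis
        using has_tcf_le_singleton[OF wo_mu tcf False] by (rule less_ad_numberI[OF _ assms(9)])
    qed
  next
    case False
    then have "mu0 <o depth_plus (card_prod mu) (less_mod D mu)" using assms(10) by simp
    from less_depth_plusD[OF less_mod_irrefl[OF assms(1)] assms(9) this]
    obtain chi :: "('k \<Rightarrow> 'm) set rel" and s where "Card_order chi" "mu0 =o chi"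
      "increasing_seq (card_prod mu) (less_mod D mu) chi s"
      by (elim exE conjE)
    then show ?thesis
      using ordIso_ordLess_trans[OF _ increasing_seq_almost_disjoint[OF assms(7,8)]] by blast
  qed
qed

end
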